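(* Let $D$ be an integral domain with quotient field $K$, let $\Theta$ be a pre-Jaffard family of $D$, and let $\{T_\alpha\}$ and $\{\Theta_\alpha\}$ (indexed by ordinals) be the derived sequence of $\Theta$ and the associated descending chain of subsets of $\Theta$. Then, for every ordinal $\alpha$: (a) $\Theta_\alpha$ is a pre-Jaffard family of $T_\alpha$; (b) if $\alpha=\gamma+1$ is a successor ordinal, then $(\Theta_\gamma)_J\cup\{T_\alpha\}$ is a weak Jaffard family of $T_\gamma$ pointed at $T_\alpha$.
   Context: All rings are integral domains; "compact" means quasi-compact. Let $E$ be a domain with quotient field $K$. An overring of $E$ is a ring $T$ with $E\subseteq T\subseteq K$; $\mathrm{Over}(E)$ is the set of overrings. The Zariski topology on $\mathrm{Over}(E)$ has as subbasis of open sets the sets $\mathcal B(x_1,\dots,x_n)=\{T\mid x_1,\dots,x_n\in T\}$, $x_i\in K$. For an overring $T$ put $\sigma(T)=\{Q\cap E\mid Q\in\mathrm{Spec}(T)\}$. An overring is flat if it is a flat $E$-module. A family $\Theta$ of overrings of $E$ is: - complete if $I=\bigcap\{IT\mid T\in\Theta\}$ for every ideal $I$ of $E$; - independent if $\sigma(A)\cap\sigma(B)=\{(0)\}$ for all distinct $A,B\in\Theta$; - locally finite if every nonzero $x\in K$ is a nonunit in only finitely many members of $\Theta$. $\Theta$ is a Jaffard family of $E$ if: either $K\notin\Theta$ or $\Theta=\{K\}$; every $T\in\Theta$ is flat over $E$; $\Theta$ is complete, independent and locally finite. A Jaffard overring of $E$ is a member of some Jaffard family of $E$. $\Theta$ is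 a pre-Jaffard family of $E$ if: either $K\notin\Theta$ or $\Theta=\{K\}$; every $T\in\Theta$ is flat over $E$; $\Theta$ is complete, independent, and compact in the Zariski topology. $\Theta$ is a weak Jaffard family of $E$ pointed at $T_\infty\in\Theta$ if: either $K\notin\Theta$ or $\Theta=\{K\}$; $\Theta$ is complete and independent; every $T\in\Theta\setminus\{T_\infty\}$ is a Jaffard overring of $E$; $T_\infty$ is flat over $E$. Derived sequence of a pre-Jaffard family $\Theta$ of $D$: $T_0:=D$, $\Theta_0:=\Theta$. For $\alpha=\gamma+1$, $\Theta_\alpha:=\Theta_\gamma\setminus(\Theta_\gamma)_J$, where $(\Theta_\gamma)_J$ is the set of those members of $\Theta_\gamma$ that are Jaffard overrings of $T_\gamma$. For $\alpha$ a limit ordinal, $\Theta_\alpha:=\bigcap_{\beta<\alpha}\Theta_\beta$. In both cases $T_\alpha:=\bigcap\{S\mid S\in\Theta_\alpha\}$, with the convention that $T_\alpha:=K$ if $\Theta_\alpha=\emptyset$.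
   Formalization: When Θ_α is empty (so T_α = K) the claim fails as stated, e.g. a DVR D with Θ = {D}, α = 1; so (a) is claimed only for nonempty Θ_α, and in (b), if Θ_α is empty and T_γ ≠ K, every clause is claimed except "K not in the family or the family is {K}". *)

theory Defs
  imports "HOL-Analysis.Function_Topology" "HOL-Algebra.Subrings" "HOL-Algebra.Free_Abelian_Groups"
begin

text \<open>
  The quotient field \<open>K\<close> is the universe of a type \<open>'k\<close> of class \<open>field\<close>, so domains and
  overrings are subsets of \<open>'k\<close> and \<open>K\<close> itself is \<open>UNIV\<close>. In particular \<open>\<Inter>{} = K\<close>.
\<close>

definition ring_on :: "'k::field set \<Rightarrow> 'k ring" where
  "ring_on E = \<lparr>carrier = E, monoid.mult = (*), one = 1, ring.zero = 0, add = (+)\<rparr>"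

definition module_on :: "'k::field set \<Rightarrow> ('k, 'k) module" where
  "module_on M =
     \<lparr>carrier = M, monoid.mult = (*), one = 1, ring.zero = 0, add = (+), smult = (*)\<rparr>"

definition domain_with_quotient_field :: "'k::field set \<Rightarrow> bool" where
  "domain_with_quotient_field D \<longleftrightarrow>
     subring D (ring_on UNIV) \<and> (\<forall>x. \<exists>a\<in>D. \<exists>b\<in>D - {0}. x = a / b)"


section \<open>Tensor products and flat modules\<close>

definition tensor_relators ::
    "('r, 'c) ring_scheme \<Rightarrow> ('r, 'm, 'd) module_scheme \<Rightarrow> ('r, 'n, 'e) module_scheme
      \<Rightarrow> ('m \<times> 'n \<Rightarrow>\<^sub>0 int) set" where
  "tensor_relators R M N =
     {frag_of (x \<oplus>\<^bsub>M\<^esub> y, z) - frag_of (x, z) - frag_of (y, z) | x y z.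
        x \<in> carrier M \<and> y \<in> carrier M \<and> z \<in> carrier N}
   \<union> {frag_of (x, y \<oplus>\<^bsub>N\<^esub> z) - frag_of (x, y) - frag_of (x, z) | x y z.
        x \<in> carrier M \<and> y \<in> carrier N \<and> z \<in> carrier N}
   \<union> {frag_of (r \<odot>\<^bsub>M\<^esub> x, y) - frag_of (x, r \<odot>\<^bsub>N\<^esub> y) | r x y.
        r \<in> carrier R \<and> x \<in> carrier M \<and> y \<in> carrier N}"

definition tensor_kernel ::
    "('r, 'c) ring_scheme \<Rightarrow> ('r, 'm, 'd) module_scheme \<Rightarrow> ('r, 'n, 'e) module_scheme
      \<Rightarrow> ('m \<times> 'n \<Rightarrow>\<^sub>0 int) set" where
  "tensor_kernel R M N =
     generate (free_Abelian_group (carrier M \<times> carrier N)) (tensor_relators R M N)"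

definition tensor_product ::
    "('r, 'c) ring_scheme \<Rightarrow> ('r, 'm, 'd) module_scheme \<Rightarrow> ('r, 'n, 'e) module_scheme
      \<Rightarrow> ('m \<times> 'n \<Rightarrow>\<^sub>0 int) set monoid" where
  "tensor_product R M N = free_Abelian_group (carrier M \<times> carrier N) Mod tensor_kernel R M N"

definition pure_tensor ::
    "('r, 'c) ring_scheme \<Rightarrow> ('r, 'm, 'd) module_scheme \<Rightarrow> ('r, 'n, 'e) module_scheme
      \<Rightarrow> 'm \<Rightarrow> 'n \<Rightarrow> ('m \<times> 'n \<Rightarrow>\<^sub>0 int) set" where
  "pure_tensor R M N x y =
     tensor_kernel R M N #>\<^bsub>free_Abelian_group (carrier M \<times> carrier N)\<^esub> frag_of (x, y)"

definition linear_maps ::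
    "('r, 'c) ring_scheme \<Rightarrow> ('r, 'm, 'd) module_scheme \<Rightarrow> ('r, 'n, 'e) module_scheme
      \<Rightarrow> ('m \<Rightarrow> 'n) set" where
  "linear_maps R M N =
     {f \<in> hom (add_monoid M) (add_monoid N).
        \<forall>r\<in>carrier R. \<forall>x\<in>carrier M. f (r \<odot>\<^bsub>M\<^esub> x) = r \<odot>\<^bsub>N\<^esub> f x}"

text \<open>
  \<open>M\<close> is flat over \<open>R\<close> if \<open>M \<otimes> -\<close> preserves injectivity of \<open>R\<close>-linear maps \<open>N \<rightarrow> N'\<close>; \<open>h\<close> below
  is the induced map \<open>M \<otimes> N \<rightarrow> M \<otimes> N'\<close>. A definition cannot quantify over all types, so the test
  modules have their carriers in the type \<open>(nat \<Rightarrow> 'r) set\<close>. It contains a copy of every finitely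
  generated \<open>R\<close>-module (the elements of a quotient of \<open>R\<^sup>n\<close> are cosets in \<open>R\<^sup>n\<close>), and testing
  flatness on injections between finitely generated modules is enough.
\<close>

definition flat_module :: "('r, 'c) ring_scheme \<Rightarrow> ('r, 'm, 'd) module_scheme \<Rightarrow> bool" where
  "flat_module R M \<longleftrightarrow> Module.module R M \<and>
     (\<forall>(N :: ('r, (nat \<Rightarrow> 'r) set) module) (N' :: ('r, (nat \<Rightarrow> 'r) set) module) f.
        Module.module R N \<and> Module.module R N' \<and> f \<in> linear_maps R N N' \<and> inj_on f (carrier N) \<longrightarrow>
        (\<exists>h \<in> mon (tensor_product R M N) (tensor_product R M N').
           \<forall>x\<in>carrier M. \<forall>y\<in>carrier N. h (pure_tensor R M N x y) = pure_tensor R M N' x (f y)))"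


section \<open>Families of overrings\<close>

definition overrings :: "'k::field set \<Rightarrow> 'k set set" where
  "overrings E = {T. subring T (ring_on UNIV) \<and> E \<subseteq> T}"

definition zariski :: "'k::field set \<Rightarrow> 'k set topology" where
  "zariski E = topology_generated_by {{T \<in> overrings E. F \<subseteq> T} | F. finite F}"

definition contracted_spectrum :: "'k::field set \<Rightarrow> 'k set \<Rightarrow> 'k set set" where
  "contracted_spectrum E T = {Q \<inter> E | Q. primeideal Q (ring_on T)}"

definition flat_overring :: "'k::field set \<Rightarrow> 'k set \<Rightarrow> bool" where
  "flat_overring E T \<longleftrightarrow> T \<in> overrings E \<and> flat_module (ring_on E) (module_on T)"

definition complete_family :: "'k::field set \<Rightarrow> 'k set set \<Rightarrow> bool" where
  "complete_family E \<Theta> \<longleftrightarrow>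
     (\<forall>I. ideal I (ring_on E) \<longrightarrow> I = (\<Inter>T\<in>\<Theta>. Idl\<^bsub>ring_on T\<^esub> I))"

definition independent_family :: "'k::field set \<Rightarrow> 'k set set \<Rightarrow> bool" where
  "independent_family E \<Theta> \<longleftrightarrow>
     (\<forall>A\<in>\<Theta>. \<forall>B\<in>\<Theta>. A \<noteq> B \<longrightarrow> contracted_spectrum E A \<inter> contracted_spectrum E B = {{0}})"

definition locally_finite_family :: "'k::field set set \<Rightarrow> bool" where
  "locally_finite_family \<Theta> \<longleftrightarrow> (\<forall>x. x \<noteq> 0 \<longrightarrow> finite {T \<in> \<Theta>. x \<notin> Units (ring_on T)})"

definition jaffard_family :: "'k::field set \<Rightarrow> 'k set set \<Rightarrow> bool" where
  "jaffard_family E \<Theta> \<longleftrightarrow>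
     \<Theta> \<subseteq> overrings E \<and> (UNIV \<notin> \<Theta> \<or> \<Theta> = {UNIV}) \<and> (\<forall>T\<in>\<Theta>. flat_overring E T) \<and>
     complete_family E \<Theta> \<and> independent_family E \<Theta> \<and> locally_finite_family \<Theta>"

definition jaffard_overring :: "'k::field set \<Rightarrow> 'k set \<Rightarrow> bool" where
  "jaffard_overring E T \<longleftrightarrow> (\<exists>\<Theta>. jaffard_family E \<Theta> \<and> T \<in> \<Theta>)"

definition pre_jaffard_family :: "'k::field set \<Rightarrow> 'k set set \<Rightarrow> bool" where
  "pre_jaffard_family E \<Theta> \<longleftrightarrow>
     \<Theta> \<subseteq> overrings E \<and> (UNIV \<notin> \<Theta> \<or> \<Theta> = {UNIV}) \<and> (\<forall>T\<in>\<Theta>. flat_overring E T) \<and>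
     complete_family E \<Theta> \<and> independent_family E \<Theta> \<and> compactin (zariski E) \<Theta>"

definition weak_jaffard_family :: "'k::field set \<Rightarrow> 'k set set \<Rightarrow> 'k set \<Rightarrow> bool" where
  "weak_jaffard_family E \<Theta> P \<longleftrightarrow>
     P \<in> \<Theta> \<and> \<Theta> \<subseteq> overrings E \<and> (UNIV \<notin> \<Theta> \<or> \<Theta> = {UNIV}) \<and>
     complete_family E \<Theta> \<and> independent_family E \<Theta> \<and>
     (\<forall>T \<in> \<Theta> - {P}. jaffard_overring E T) \<and> flat_overring E P"

definition jaffard_members :: "'k::field set \<Rightarrow> 'k set set \<Rightarrow> 'k set set" where
  "jaffard_members E \<Theta> = {T \<in> \<Theta>. jaffard_overring E T}"


section \<open>The derived sequence\<close>

text \<open>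
  Ordinals are elements of an arbitrary well-ordered type: every ordinal is the position of some
  element in some well-order, and the sequence at an element depends only on its predecessors.
\<close>

definition is_zero :: "'o::wellorder \<Rightarrow> bool" where
  "is_zero \<alpha> \<longleftrightarrow> (\<forall>\<beta>. \<alpha> \<le> \<beta>)"

definition is_successor :: "'o::wellorder \<Rightarrow> 'o \<Rightarrow> bool" where
  "is_successor \<gamma> \<alpha> \<longleftrightarrow> \<gamma> < \<alpha> \<and> (\<forall>\<beta><\<alpha>. \<beta> \<le> \<gamma>)"

definition is_limit :: "'o::wellorder \<Rightarrow> bool" where
  "is_limit \<alpha> \<longleftrightarrow> \<not> is_zero \<alpha> \<and> (\<nexists>\<gamma>. is_successor \<gamma> \<alpha>)"

lemma is_successor_unique: "is_successor \<gamma> \<alpha> \<Longrightarrow> is_successor \<delta> \<alpha> \<Longrightarrow> \<gamma> = \<delta>"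
  by (meson antisym is_successor_def)

lemma the_predecessor: "is_successor \<gamma> \<alpha> \<Longrightarrow> (THE \<delta>. is_successor \<delta> \<alpha>) = \<gamma>"
  by (blast intro: is_successor_unique)

text \<open>\<open>stage_ring D \<alpha> \<Theta>\<^sub>\<alpha>\<close> is \<open>T\<^sub>\<alpha>\<close>.\<close>

definition stage_ring :: "'k::field set \<Rightarrow> 'o::wellorder \<Rightarrow> 'k set set \<Rightarrow> 'k set" where
  "stage_ring D \<alpha> \<Phi> = (if is_zero \<alpha> then D else if \<Phi> = {} then UNIV else \<Inter>\<Phi>)"

function derived_family :: "'k::field set \<Rightarrow> 'k set set \<Rightarrow> 'o::wellorder \<Rightarrow> 'k set set" where
  "derived_family D \<Theta> \<alpha> =
     (if is_zero \<alpha> then \<Theta>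
      else if \<exists>\<gamma>. is_successor \<gamma> \<alpha> then
        (let \<gamma> = (THE \<gamma>. is_successor \<gamma> \<alpha>); \<Phi> = derived_family D \<Theta> \<gamma>
         in \<Phi> - jaffard_members (stage_ring D \<gamma> \<Phi>) \<Phi>)
      else (\<Inter>\<beta>\<in>{..<\<alpha>}. derived_family D \<Theta> \<beta>))"
  by pat_completeness auto
termination
proof (relation "inv_image {(\<beta>, \<alpha>). \<beta> < \<alpha>} (\<lambda>(D, \<Theta>, \<alpha>). \<alpha>)", goal_cases)
  case 1
  show ?case
    by (rule wf_inv_image) (rule wf)
next
  case (2 D \<Theta> \<alpha> \<delta>)
  then obtain \<gamma> where "is_successor \<gamma> \<alpha>"
    by blast
  with 2 show ?case
    by (metis (mono_tags, lifting) case_prodI in_inv_image is_successor_def mem_Collect_eq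
        prod.case the_predecessor)
next
  case (3 D \<Theta> \<alpha> \<beta>)
  then show ?case
    by simp
qed

declare derived_family.simps [simp del]

definition derived_ring :: "'k::field set \<Rightarrow> 'k set set \<Rightarrow> 'o::wellorder \<Rightarrow> 'k set" where
  "derived_ring D \<Theta> \<alpha> = stage_ring D \<alpha> (derived_family D \<Theta> \<alpha>)"

lemma derived_family_zero: "is_zero \<alpha> \<Longrightarrow> derived_family D \<Theta> \<alpha> = \<Theta>"
  by (simp add: derived_family.simps)

lemma derived_family_successor:
  assumes "is_successor \<gamma> \<alpha>"
  shows "derived_family D \<Theta> \<alpha> =
    derived_family D \<Theta> \<gamma> - jaffard_members (derived_ring D \<Theta> \<gamma>) (derived_family D \<Theta> \<gamma>)"
proof -
  have "\<not> is_zero \<alpha>"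
    using assms by (auto simp: is_zero_def is_successor_def not_le)
  then show ?thesis
    using assms
    by (subst derived_family.simps) (auto simp: the_predecessor derived_ring_def Let_def)
qed

lemma derived_family_limit:
  "is_limit \<alpha> \<Longrightarrow> derived_family D \<Theta> \<alpha> = (\<Inter>\<beta>\<in>{..<\<alpha>}. derived_family D \<Theta> \<beta>)"
  by (subst derived_family.simps) (auto simp: is_limit_def)

lemma derived_ring_zero: "is_zero \<alpha> \<Longrightarrow> derived_ring D \<Theta> \<alpha> = D"
  by (simp add: derived_ring_def stage_ring_def)

lemma derived_ring_nonzero:
  "\<not> is_zero \<alpha> \<Longrightarrow> derived_ring D \<Theta> \<alpha> = \<Inter>(derived_family D \<Theta> \<alpha>)"
  by (simp add: derived_ring_def stage_ring_def)


section \<open>The degenerate stage \<open>\<Theta>\<^sub>\<alpha> = {}\<close>\<close>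

text \<open>
  Once \<open>\<Theta>\<^sub>\<alpha> = {}\<close> the convention gives \<open>T\<^sub>\<alpha> = K\<close>. The empty family is then not complete (the zero
  ideal fails), and the only weak Jaffard family with point \<open>K\<close> is \<open>{K}\<close>. So the stage \<open>\<Theta>\<^sub>\<alpha> = {}\<close>
  must be treated separately whenever pre-Jaffard and weak Jaffard families are claimed.
\<close>

lemma not_complete_empty: "subring E (ring_on UNIV) \<Longrightarrow> \<not> complete_family E {}"
proof
  assume E: "subring E (ring_on UNIV)" and c: "complete_family E {}"
  have "ring (ring_on (UNIV :: 'a set))"
  proof (intro ringI abelian_groupI monoidI)
    fix x :: 'a
    assume "x \<in> carrier (ring_on UNIV)"
    show "\<exists>y\<in>carrier (ring_on UNIV). y \<oplus>\<^bsub>ring_on UNIV\<^esub> x = \<zero>\<^bsub>ring_on UNIV\<^esub>"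
      by (rule bexI[of _ "- x"]) (simp_all add: ring_on_def)
  qed (simp_all add: ring_on_def algebra_simps)
  then have "ring ((ring_on UNIV)\<lparr>carrier := E\<rparr>)"
    using E by (rule ring.subring_is_ring)
  then have "ring (ring_on E)"
    by (simp add: ring_on_def)
  then have "ideal {\<zero>\<^bsub>ring_on E\<^esub>} (ring_on E)"
    by (rule ring.zeroideal)
  then have "ideal {0} (ring_on E)"
    by (simp add: ring_on_def)
  then have "{0} = (UNIV :: 'a set)"
    using c unfolding complete_family_def by simp
  then have "(1 :: 'a) \<in> {0}"
    by blast
  then show False
    by simp
qed

lemma weak_jaffard_family_point_UNIV:
  "weak_jaffard_family E \<Theta> UNIV \<Longrightarrow> \<Theta> = {UNIV}"
  by (auto simp: weak_jaffard_family_def)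

end

theory Submission
  imports Defs
begin

text \<open>
  Flatness of an overring \<open>T\<close> of \<open>E\<close> amounts to \<open>(E : x) T = T\<close> for all \<open>x \<in> T\<close>, where
  \<open>(E : x)\<close> is the conductor. Under this criterion a family \<open>\<Theta>\<close> of flat overrings is complete iff
  no proper ideal \<open>L\<close> of \<open>E\<close> satisfies \<open>L T = T\<close> for all \<open>T \<in> \<Theta>\<close>, and \<open>A\<close>, \<open>B\<close> are independent iff
  \<open>A B = K\<close>, that is, \<open>(B : x) A = A\<close> for all \<open>x\<close>.

  If \<open>\<Lambda> \<subseteq> \<Theta>\<close> is compact and \<open>C = \<Inter>\<Lambda>\<close>, compactness gives \<open>C T = K\<close> for \<open>T \<in> \<Theta> - \<Lambda>\<close>. Hence an ideal
  \<open>L\<close> of \<open>C\<close> that blows up in all members of \<open>\<Lambda>\<close> contracts to an ideal of \<open>D\<close> that blows up in all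
  members of \<open>\<Theta>\<close>, so \<open>\<Lambda>\<close> is a pre-Jaffard family of \<open>C\<close> and \<open>C\<close> is flat over \<open>D\<close>.

  It remains to see that each \<open>\<Theta>\<^sub>\<alpha>\<close> is compact. If \<open>T\<close> is a Jaffard overring then
  \<open>T \<cdot> \<Inter>(\<Theta> - {T}) = K\<close>, so for every finite \<open>F\<close> there is a neighbourhood of \<open>T\<close> all of whose other
  members contain \<open>F\<close>. Given a cover of \<open>\<Theta>\<^sub>\<alpha>\<close> by basic open sets, these neighbourhoods of the
  members that left at earlier stages, taken for one fixed member \<open>F\<close> of the cover, extend it to a
  cover of \<open>\<Theta>\<close> without adding anything new inside \<open>\<Theta>\<^sub>\<alpha>\<close>.
\<close>

section \<open>Subrings, ideals and products of ideals with overrings\<close>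

lemma ring_on_simps [simp]:
  "carrier (ring_on E) = E" "x \<otimes>\<^bsub>ring_on E\<^esub> y = x * y" "\<one>\<^bsub>ring_on E\<^esub> = 1"
  "\<zero>\<^bsub>ring_on E\<^esub> = 0" "x \<oplus>\<^bsub>ring_on E\<^esub> y = x + y"
  by (simp_all add: ring_on_def)

lemma cring_ring_on_UNIV: "cring (ring_on (UNIV :: 'k::field set))"
proof (intro cringI abelian_groupI comm_monoidI)
  fix x :: 'k
  assume "x \<in> carrier (ring_on UNIV)"
  show "\<exists>y\<in>carrier (ring_on UNIV). y \<oplus>\<^bsub>ring_on UNIV\<^esub> x = \<zero>\<^bsub>ring_on UNIV\<^esub>"
    by (rule bexI[of _ "- x"]) simp_all
qed (simp_all add: algebra_simps)

lemma a_inv_ring_on_UNIV [simp]: "\<ominus>\<^bsub>ring_on UNIV\<^esub> (x :: 'k::field) = - x"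
proof -
  interpret cring "ring_on (UNIV :: 'k set)"
    by (rule cring_ring_on_UNIV)
  show ?thesis
    by (rule minus_equality) simp_all
qed

lemma subring_ring_on_iff:
  "subring E (ring_on (UNIV :: 'k::field set)) \<longleftrightarrow>
     1 \<in> E \<and> (\<forall>x\<in>E. - x \<in> E) \<and> (\<forall>x\<in>E. \<forall>y\<in>E. x + y \<in> E) \<and> (\<forall>x\<in>E. \<forall>y\<in>E. x * y \<in> E)"
proof
  assume "subring E (ring_on (UNIV :: 'k set))"
  then interpret subring E "ring_on (UNIV :: 'k set)" .
  interpret R: cring "ring_on (UNIV :: 'k set)"
    by (rule cring_ring_on_UNIV)
  show "1 \<in> E \<and> (\<forall>x\<in>E. - x \<in> E) \<and> (\<forall>x\<in>E. \<forall>y\<in>E. x + y \<in> E) \<and> (\<forall>x\<in>E. \<forall>y\<in>E. x * y \<in> E)"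
    using subringE(3,5-7)[OF subring_axioms] by simp
next
  interpret cring "ring_on (UNIV :: 'k set)"
    by (rule cring_ring_on_UNIV)
  assume "1 \<in> E \<and> (\<forall>x\<in>E. - x \<in> E) \<and> (\<forall>x\<in>E. \<forall>y\<in>E. x + y \<in> E) \<and> (\<forall>x\<in>E. \<forall>y\<in>E. x * y \<in> E)"
  then show "subring E (ring_on UNIV)"
    by (intro subringI) auto
qed

definition subrng :: "'k::field set \<Rightarrow> bool" where
  "subrng E \<longleftrightarrow> subring E (ring_on UNIV)"

lemma subrngD:
  assumes "subrng E"
  shows "1 \<in> E" "0 \<in> E" "x \<in> E \<Longrightarrow> - x \<in> E" "x \<in> E \<Longrightarrow> y \<in> E \<Longrightarrow> x + y \<in> E"
    "x \<in> E \<Longrightarrow> y \<in> E \<Longrightarrow> x - y \<in> E" "x \<in> E \<Longrightarrow> y \<in> E \<Longrightarrow> x * y \<in> E"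
proof -
  have *: "1 \<in> E" "\<And>x. x \<in> E \<Longrightarrow> - x \<in> E" "\<And>x y. x \<in> E \<Longrightarrow> y \<in> E \<Longrightarrow> x + y \<in> E"
    "\<And>x y. x \<in> E \<Longrightarrow> y \<in> E \<Longrightarrow> x * y \<in> E"
    using assms by (auto simp: subrng_def subring_ring_on_iff)
  have "- 1 + 1 \<in> E"
    using * by blast
  then show "0 \<in> E" by simp
  show "1 \<in> E" "x \<in> E \<Longrightarrow> - x \<in> E" "x \<in> E \<Longrightarrow> y \<in> E \<Longrightarrow> x + y \<in> E" "x \<in> E \<Longrightarrow> y \<in> E \<Longrightarrow> x * y \<in> E"
    using * by blast+
  show "x \<in> E \<Longrightarrow> y \<in> E \<Longrightarrow> x - y \<in> E"
    using *(2)[of y] *(3)[of x "- y"] by simp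
qed

lemma cring_ring_on: "subrng E \<Longrightarrow> cring (ring_on E)"
proof (intro cringI abelian_groupI comm_monoidI)
  fix x :: 'a
  assume "subrng E" "x \<in> carrier (ring_on E)"
  then show "\<exists>y\<in>carrier (ring_on E). y \<oplus>\<^bsub>ring_on E\<^esub> x = \<zero>\<^bsub>ring_on E\<^esub>"
    by (intro bexI[of _ "- x"]) (simp_all add: subrngD)
qed (simp_all add: algebra_simps subrngD)

text \<open>Closure under negatives comes from multiplication by \<open>- 1\<close>, which lies in
  every subring \<open>E\<close>.\<close>

definition ideal_on :: "'k::field set \<Rightarrow> 'k set \<Rightarrow> bool" where
  "ideal_on E I \<longleftrightarrow> I \<subseteq> E \<and> 0 \<in> I \<and> (\<forall>x\<in>I. \<forall>y\<in>I. x + y \<in> I) \<and> (\<forall>r\<in>E. \<forall>x\<in>I. r * x \<in> I)"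

lemma ideal_onD:
  assumes "ideal_on E I"
  shows "x \<in> I \<Longrightarrow> x \<in> E" "0 \<in> I" "x \<in> I \<Longrightarrow> y \<in> I \<Longrightarrow> x + y \<in> I"
    "r \<in> E \<Longrightarrow> x \<in> I \<Longrightarrow> r * x \<in> I"
  using assms by (auto simp: ideal_on_def)

lemma ideal_ring_on_iff:
  assumes E: "subrng E"
  shows "ideal I (ring_on E) \<longleftrightarrow> ideal_on E I"
proof
  assume "ideal I (ring_on E)"
  then interpret ideal I "ring_on E" .
  show "ideal_on E I"
    using a_subset additive_subgroup.a_closed[OF additive_subgroup_axioms]
      additive_subgroup.zero_closed[OF additive_subgroup_axioms] I_l_closed
    by (auto simp: ideal_on_def)
next
  assume I: "ideal_on E I"
  interpret cring "ring_on E"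
    using E by (rule cring_ring_on)
  have neg: "\<ominus>\<^bsub>ring_on E\<^esub> x = - x" if "x \<in> E" for x
    using that E by (intro minus_equality) (simp_all add: subrngD)
  have "- x \<in> I" if "x \<in> I" for x
    using ideal_onD(4)[OF I, of "- 1" x] subrngD[OF E] that by auto
  then have "\<ominus>\<^bsub>ring_on E\<^esub> x \<in> I" if "x \<in> I" for x
    using neg[of x] ideal_onD(1)[OF I that] that by simp
  then have "subgroup I (add_monoid (ring_on E))"
    unfolding a_inv_def using I by (intro subgroup.intro) (auto simp: ideal_on_def)
  then show "ideal I (ring_on E)"
    using ideal_onD(4)[OF I] by (intro idealI ring_axioms) (auto, metis mult.commute)
qed

lemma primeideal_ring_on_iff:
  assumes E: "subrng E"
  shows "primeideal Q (ring_on E) \<longleftrightarrow>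
    ideal_on E Q \<and> 1 \<notin> Q \<and> (\<forall>a\<in>E. \<forall>b\<in>E. a * b \<in> Q \<longrightarrow> a \<in> Q \<or> b \<in> Q)"
proof -
  have "E \<noteq> Q \<longleftrightarrow> 1 \<notin> Q" if "ideal_on E Q"
    using ideal_onD[OF that] subrngD(1)[OF E] by (metis mult.right_neutral subsetI subset_antisym)
  then show ?thesis
    using cring_ring_on[OF E]
    by (auto simp: primeideal_def primeideal_axioms_def ideal_ring_on_iff[OF E])
qed

section \<open>Extension of ideals as finite sums of products\<close>

text \<open>For a subring \<open>T\<close> and \<open>S \<subseteq> T\<close> this is the ideal
  \<open>S T\<close>. Both arguments are arbitrary sets, so that generators and coefficients can
  each be shrunk to finite sets.\<close>

inductive_set mult_span :: "'k::field set \<Rightarrow> 'k set \<Rightarrow> 'k set" for S T where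
  zero: "0 \<in> mult_span S T"
| step: "s \<in> S \<Longrightarrow> t \<in> T \<Longrightarrow> x \<in> mult_span S T \<Longrightarrow> s * t + x \<in> mult_span S T"

lemma mult_span_mono: "x \<in> mult_span S T \<Longrightarrow> S \<subseteq> S' \<Longrightarrow> T \<subseteq> T' \<Longrightarrow> x \<in> mult_span S' T'"
  by (induction rule: mult_span.induct) (auto intro: mult_span.intros)

lemma mult_span_mult: "s \<in> S \<Longrightarrow> t \<in> T \<Longrightarrow> s * t \<in> mult_span S T"
  using mult_span.step[OF _ _ mult_span.zero] by fastforce

lemma mult_span_add: "x \<in> mult_span S T \<Longrightarrow> y \<in> mult_span S T \<Longrightarrow> x + y \<in> mult_span S T"
  by (induction rule: mult_span.induct) (auto intro: mult_span.intros simp: add.assoc)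

text \<open>A sum uses only finitely many generators and coefficients. This finiteness is what
  compactness is later applied to.\<close>

lemma mult_span_finite:
  "x \<in> mult_span S T \<Longrightarrow> \<exists>G H. finite G \<and> G \<subseteq> S \<and> finite H \<and> H \<subseteq> T \<and> x \<in> mult_span G H"
proof (induction rule: mult_span.induct)
  case zero
  then show ?case
    by (blast intro: mult_span.zero)
next
  case (step s t x)
  then obtain G H where GH: "finite G" "G \<subseteq> S" "finite H" "H \<subseteq> T" "x \<in> mult_span G H"
    by blast
  have "s * t + x \<in> mult_span (insert s G) (insert t H)"
    using GH(5) by (intro mult_span.step) (auto intro: mult_span_mono)
  then show ?case
    using GH step.hyps by (intro exI[of _ "insert s G"] exI[of _ "insert t H"]) auto
qed

text \<open>\<open>z * x\<close> is a combination, with coefficients in \<open>T\<close>, of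
  elements \<open>s * x\<close> of \<open>M\<close>. The usual case is \<open>z = 1\<close>: if
  denominators that carry \<open>x\<close> into \<open>M\<close> generate the unit ideal, then
  \<open>x\<close> itself lies in \<open>M\<close>.\<close>

lemma mult_span_absorb:
  assumes "z \<in> mult_span S T" and "\<And>s. s \<in> S \<Longrightarrow> s * x \<in> M" and "0 \<in> M"
    and "\<And>u v. u \<in> M \<Longrightarrow> v \<in> M \<Longrightarrow> u + v \<in> M" and "\<And>t u. t \<in> T \<Longrightarrow> u \<in> M \<Longrightarrow> t * u \<in> M"
  shows "z * x \<in> M"
  using assms(1)
proof induction
  case zero
  show ?case using assms(3) by simp
next
  case (step s t y)
  have "(s * t + y) * x = t * (s * x) + y * x"
    by (simp add: algebra_simps)
  then show ?case
    using step assms by simp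
qed

lemma mult_span_scale:
  assumes "x \<in> mult_span S T" and "r \<in> T" and "\<And>t u. t \<in> T \<Longrightarrow> u \<in> T \<Longrightarrow> t * u \<in> T"
  shows "r * x \<in> mult_span S T"
  using assms(1)
proof induction
  case (step s t y)
  have "r * (s * t + y) = s * (r * t) + r * y"
    by (simp add: algebra_simps)
  then show ?case
    using step assms by (auto intro: mult_span.step)
qed (simp add: mult_span.zero)

text \<open>The product of two unit ideals is the unit ideal. Denominators for two purposes can thus
  be multiplied into denominators that serve both, and by induction finitely many purposes.\<close>

lemma one_in_mult_span_mult:
  assumes "1 \<in> mult_span S T" and "1 \<in> mult_span S' T" and "subrng T"
    and "\<And>s s'. s \<in> S \<Longrightarrow> s' \<in> S' \<Longrightarrow> s * s' \<in> X"
  shows "1 \<in> mult_span X T"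
proof -
  have M: "t * x \<in> mult_span X T" if "t \<in> T" "x \<in> mult_span X T" for t x
    using that assms(3) by (auto intro: mult_span_scale subrngD)
  have "s' \<in> mult_span X T" if "s' \<in> S'" for s'
  proof -
    have "s * s' \<in> mult_span X T" if "s \<in> S" for s
      using mult_span_mult[OF assms(4)[OF that \<open>s' \<in> S'\<close>] subrngD(1)[OF assms(3)]] by simp
    then have "1 * s' \<in> mult_span X T"
      by (rule mult_span_absorb[OF assms(1)]) (auto intro: M mult_span.zero mult_span_add)
    then show ?thesis by simp
  qed
  then have "1 * 1 \<in> mult_span X T"
    by (intro mult_span_absorb[OF assms(2)]) (auto intro: M mult_span.zero mult_span_add)
  then show ?thesis by simp
qed

lemma mult_span_subset:
  assumes "subrng T" "S \<subseteq> T" shows "mult_span S T \<subseteq> T"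
proof
  fix x assume "x \<in> mult_span S T"
  then show "x \<in> T"
    by induction (use assms in \<open>auto intro!: subrngD\<close>)
qed

lemma ideal_on_mult_span: "subrng T \<Longrightarrow> S \<subseteq> T \<Longrightarrow> ideal_on T (mult_span S T)"
  by (auto simp: ideal_on_def intro: mult_span.zero mult_span_add mult_span_scale subrngD
      dest: mult_span_subset[THEN subsetD])

text \<open>Links the generated ideals in \<open>complete_family\<close> to explicit sums.\<close>

lemma genideal_ring_on:
  assumes "subrng T" "S \<subseteq> T"
  shows "Idl\<^bsub>ring_on T\<^esub> S = mult_span S T"
proof
  have "S \<subseteq> mult_span S T"
    using mult_span_mult[of _ S 1 T] subrngD(1)[OF assms(1)] by auto
  then show "Idl\<^bsub>ring_on T\<^esub> S \<subseteq> mult_span S T"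
    using ideal_on_mult_span[OF assms] by (auto simp: genideal_def ideal_ring_on_iff[OF assms(1)])
  have "x \<in> J" if J: "ideal_on T J" "S \<subseteq> J" and x: "x \<in> mult_span S T" for x J
    using x
  proof induction
    case (step s t x)
    then show ?case
      using ideal_onD(3,4)[OF J(1)] J(2) by (metis mult.commute subsetD)
  qed (rule ideal_onD(2)[OF J(1)])
  then show "mult_span S T \<subseteq> Idl\<^bsub>ring_on T\<^esub> S"
    by (auto simp: genideal_def ideal_ring_on_iff[OF assms(1)])
qed

section \<open>Conductors and the conditions expressed by them\<close>

text \<open>The colon \<open>(B : x)\<close>, consisting of denominators in \<open>E\<close>. Here
  \<open>B\<close> may be \<open>E\<close>, an ideal of \<open>E\<close> or an overring.\<close>

definition conductor :: "'k::field set \<Rightarrow> 'k set \<Rightarrow> 'k \<Rightarrow> 'k set" where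
  "conductor E B x = {d \<in> E. d * x \<in> B}"

definition conductor_flat :: "'k::field set \<Rightarrow> 'k set \<Rightarrow> bool" where
  "conductor_flat E T \<longleftrightarrow> (\<forall>x\<in>T. 1 \<in> mult_span (conductor E E x) T)"

text \<open>An asymmetric form of \<open>A B = K\<close>: the denominators are measured in
  \<open>A\<close> and act into \<open>B\<close>. Taking them from \<open>E\<close> allows
  denominators for different \<open>B\<close> to be multiplied.\<close>

definition generates_field :: "'k::field set \<Rightarrow> 'k set \<Rightarrow> 'k set \<Rightarrow> bool" where
  "generates_field E A B \<longleftrightarrow> (\<forall>x. 1 \<in> mult_span (conductor E B x) A)"

text \<open>Compactness tested on basic open sets, with \<open>F T\<close> describing the
  neighbourhood chosen for \<open>T\<close>. No base ring occurs, so the condition serves the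
  topologies over \<open>D\<close> and over a larger base ring alike.\<close>

definition finite_covers :: "'k set set \<Rightarrow> bool" where
  "finite_covers \<Theta> \<longleftrightarrow>
     (\<forall>F. (\<forall>T\<in>\<Theta>. finite (F T) \<and> F T \<subseteq> T) \<longrightarrow>
          (\<exists>\<Theta>\<^sub>0\<subseteq>\<Theta>. finite \<Theta>\<^sub>0 \<and> (\<forall>T\<in>\<Theta>. \<exists>S\<in>\<Theta>\<^sub>0. F S \<subseteq> T)))"

lemma dwqfD:
  assumes "domain_with_quotient_field E"
  shows "subrng E" "\<exists>a\<in>E. \<exists>b\<in>E - {0}. x = a / b"
  using assms by (auto simp: domain_with_quotient_field_def subrng_def)

lemma overringsD: "T \<in> overrings E \<Longrightarrow> subrng T" "T \<in> overrings E \<Longrightarrow> E \<subseteq> T"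
  by (auto simp: overrings_def subrng_def)

lemma overringsI: "subrng T \<Longrightarrow> E \<subseteq> T \<Longrightarrow> T \<in> overrings E"
  by (auto simp: overrings_def subrng_def)

lemma domain_with_quotient_field_overring:
  "domain_with_quotient_field E \<Longrightarrow> T \<in> overrings E \<Longrightarrow> domain_with_quotient_field T"
  unfolding domain_with_quotient_field_def overrings_def by blast

lemma subrng_Inter: "(\<And>T. T \<in> \<Lambda> \<Longrightarrow> subrng T) \<Longrightarrow> subrng (\<Inter>\<Lambda>)"
  unfolding subrng_def subring_ring_on_iff by blast

lemma subrng_UNIV: "subrng UNIV"
  by (simp add: subrng_def subring_ring_on_iff)

lemma ideal_on_conductor:
  assumes "subrng E" "ideal_on E I"
  shows "ideal_on E (conductor E I x)"
  using subrngD(2,4,6)[OF assms(1)] ideal_onD(2-4)[OF assms(2)]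
  by (simp add: ideal_on_def conductor_def distrib_right mult.assoc)

lemma ideal_on_conductor_overring:
  assumes "subrng E" "T \<in> overrings E"
  shows "ideal_on E (conductor E T x)"
  using subrngD(2,4,6)[OF assms(1)] subrngD(2,4,6)[OF overringsD(1)[OF assms(2)]]
    overringsD(2)[OF assms(2)]
  by (simp add: ideal_on_def conductor_def distrib_right mult.assoc subset_iff)

lemma one_in_mult_span_self:
  "subrng T \<Longrightarrow> 1 \<in> I \<Longrightarrow> 1 \<in> mult_span I T"
  using mult_span_mult[of 1 I 1 T] subrngD(1) by auto

section \<open>Flat overrings\<close>

lemma module_on_simps [simp]:
  "carrier (module_on M) = M" "x \<oplus>\<^bsub>module_on M\<^esub> y = x + y" "\<zero>\<^bsub>module_on M\<^esub> = 0"
  "r \<odot>\<^bsub>module_on M\<^esub> x = r * x"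
  by (simp_all add: module_on_def)

lemma module_module_on:
  assumes "subrng E" "T \<in> overrings E"
  shows "Module.module (ring_on E) (module_on T)"
proof (rule moduleI)
  note T' = subrngD[OF overringsD(1)[OF assms(2)]]
  show "cring (ring_on E)"
    using assms(1) by (rule cring_ring_on)
  show "abelian_group (module_on T)"
  proof (rule abelian_groupI)
    fix x assume "x \<in> carrier (module_on T)"
    then show "\<exists>y\<in>carrier (module_on T). y \<oplus>\<^bsub>module_on T\<^esub> x = \<zero>\<^bsub>module_on T\<^esub>"
      using T'(3) by (intro bexI[of _ "- x"]) auto
  qed (use T' in \<open>simp_all add: algebra_simps\<close>)
next
  fix r x
  assume "r \<in> carrier (ring_on E)" "x \<in> carrier (module_on T)"
  then show "r \<odot>\<^bsub>module_on T\<^esub> x \<in> carrier (module_on T)"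
    using overringsD(2)[OF assms(2)] subrngD(6)[OF overringsD(1)[OF assms(2)]] by auto
qed (simp_all add: distrib_right distrib_left mult.assoc)

section \<open>Kernels of tensor products\<close>

lemma keys_frag_diff_subset:
  "Poly_Mapping.keys a \<subseteq> S \<Longrightarrow> Poly_Mapping.keys b \<subseteq> S \<Longrightarrow> Poly_Mapping.keys (a - b) \<subseteq> S"
  using keys_diff[of a b] by blast

lemma tensor_relators_subset:
  assumes "Module.module R M" "Module.module R N"
  shows "tensor_relators R M N \<subseteq> carrier (free_Abelian_group (carrier M \<times> carrier N))"
proof -
  interpret M: Module.module R M by fact
  interpret N: Module.module R N by fact
  show ?thesis
  proof
    fix w assume "w \<in> tensor_relators R M N"
    then show "w \<in> carrier (free_Abelian_group (carrier M \<times> carrier N))"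
      unfolding tensor_relators_def
      by (elim UnE CollectE exE conjE) (simp_all add: keys_frag_diff_subset)
  qed
qed

lemma subgroup_tensor_kernel:
  assumes "Module.module R M" "Module.module R N"
  shows "subgroup (tensor_kernel R M N) (free_Abelian_group (carrier M \<times> carrier N))"
  unfolding tensor_kernel_def
  using tensor_relators_subset[OF assms] by (intro group.generate_is_subgroup) simp_all

lemma tensor_kernel_subset:
  assumes "tensor_relators R M N \<subseteq> H" "subgroup H (free_Abelian_group (carrier M \<times> carrier N))"
  shows "tensor_kernel R M N \<subseteq> H"
  unfolding tensor_kernel_def using assms by (intro group.generate_subgroup_incl) simp_all

lemma tensor_kernelD:
  assumes "Module.module R M" "Module.module R N"
  shows "0 \<in> tensor_kernel R M N"
    and "w \<in> tensor_kernel R M N \<Longrightarrow> Poly_Mapping.keys w \<subseteq> carrier M \<times> carrier N"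
    and "w \<in> tensor_kernel R M N \<Longrightarrow> - w \<in> tensor_kernel R M N"
    and "v \<in> tensor_kernel R M N \<Longrightarrow> w \<in> tensor_kernel R M N \<Longrightarrow> v + w \<in> tensor_kernel R M N"
    and "v \<in> tensor_kernel R M N \<Longrightarrow> w \<in> tensor_kernel R M N \<Longrightarrow> v - w \<in> tensor_kernel R M N"
proof -
  note K = subgroup_tensor_kernel[OF assms]
  show "0 \<in> tensor_kernel R M N"
    using subgroup.one_closed[OF K] by simp
  show keys: "Poly_Mapping.keys w \<subseteq> carrier M \<times> carrier N" if "w \<in> tensor_kernel R M N" for w
    using subgroup.mem_carrier[OF K that] by simp
  show neg: "- w \<in> tensor_kernel R M N" if "w \<in> tensor_kernel R M N" for w
    using subgroup.m_inv_closed[OF K that] keys[OF that] by simp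
  show add: "v + w \<in> tensor_kernel R M N" if "v \<in> tensor_kernel R M N" "w \<in> tensor_kernel R M N" for v w
    using subgroup.m_closed[OF K that] by simp
  show "v - w \<in> tensor_kernel R M N" if "v \<in> tensor_kernel R M N" "w \<in> tensor_kernel R M N" for v w
    using add[OF that(1) neg[OF that(2)]] by simp
qed

lemma tensor_relatorI:
  shows "x \<in> carrier M \<Longrightarrow> y \<in> carrier M \<Longrightarrow> z \<in> carrier N \<Longrightarrow>
      frag_of (x \<oplus>\<^bsub>M\<^esub> y, z) - frag_of (x, z) - frag_of (y, z) \<in> tensor_kernel R M N"
    and "x \<in> carrier M \<Longrightarrow> z \<in> carrier N \<Longrightarrow> z' \<in> carrier N \<Longrightarrow>
      frag_of (x, z \<oplus>\<^bsub>N\<^esub> z') - frag_of (x, z) - frag_of (x, z') \<in> tensor_kernel R M N"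
    and "r \<in> carrier R \<Longrightarrow> x \<in> carrier M \<Longrightarrow> z \<in> carrier N \<Longrightarrow>
      frag_of (r \<odot>\<^bsub>M\<^esub> x, z) - frag_of (x, r \<odot>\<^bsub>N\<^esub> z) \<in> tensor_kernel R M N"
  unfolding tensor_kernel_def tensor_relators_def by (blast intro: generate.incl)+

lemma subgroup_free_Abelian_groupI:
  assumes "\<And>w. w \<in> H \<Longrightarrow> Poly_Mapping.keys w \<subseteq> S" "0 \<in> H"
    and "\<And>v w. v \<in> H \<Longrightarrow> w \<in> H \<Longrightarrow> v + w \<in> H" "\<And>w. w \<in> H \<Longrightarrow> - w \<in> H"
  shows "subgroup H (free_Abelian_group S)"
  by (rule subgroup.intro) (use assms in auto)

section \<open>Detecting zero in a tensor product by clearing denominators\<close>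

text \<open>Multiplying the ideals \<open>(E : t)\<close> for the finitely many
  \<open>t \<in> P\<close> gives common denominators that still generate the unit ideal of
  \<open>T\<close>.\<close>

lemma conductor_flat_finite:
  assumes E: "subrng E" and T: "T \<in> overrings E" "conductor_flat E T" and "finite P" "P \<subseteq> T"
  shows "1 \<in> mult_span {a \<in> E. \<forall>t\<in>P. a * t \<in> E} T"
  using assms(4,5)
proof (induction rule: finite_induct)
  case empty
  show ?case
    using subrngD(1)[OF E] overringsD(1)[OF T(1)] by (intro one_in_mult_span_self) auto
next
  case (insert t P)
  have "1 \<in> mult_span (conductor E E t) T" "1 \<in> mult_span {a \<in> E. \<forall>t\<in>P. a * t \<in> E} T"
    using insert T(2) by (auto simp: conductor_flat_def)
  from this overringsD(1)[OF T(1)] show ?case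
  proof (rule one_in_mult_span_mult)
    fix d e assume d: "d \<in> conductor E E t" and e: "e \<in> {a \<in> E. \<forall>t\<in>P. a * t \<in> E}"
    have "e * (d * t) \<in> E"
      using d e subrngD(6)[OF E] by (auto simp: conductor_def)
    then have "d * e * t \<in> E"
      by (simp add: mult_ac)
    moreover have "d * e * s \<in> E" if "s \<in> P" for s
      using d e that subrngD(6)[OF E, of d "e * s"] by (auto simp: conductor_def mult.assoc)
    ultimately show "d * e \<in> {a \<in> E. \<forall>t\<in>insert t P. a * t \<in> E}"
      using d e subrngD(6)[OF E] by (auto simp: conductor_def)
  qed
qed

lemma (in abelian_group) add_minus_minus:
  assumes "x \<in> carrier G" "y \<in> carrier G"
  shows "x \<oplus> y \<ominus> x \<ominus> y = \<zero>"
proof -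
  have "x \<oplus> y \<ominus> x = y"
    using assms by (simp add: a_minus_def a_comm[of x y] a_assoc r_neg)
  then show ?thesis
    using assms by (simp add: a_minus_def r_neg)
qed

text \<open>
  Multiplication by \<open>a \<in> E\<close> moves \<open>t \<otimes> n\<close> into \<open>N\<close> as \<open>(a t) n\<close> when \<open>a t \<in> E\<close>; the other pure tensors are
  sent to the junk value \<open>0\<close>, which is harmless because for flat \<open>T\<close> there are enough \<open>a\<close> with
  \<open>a t \<in> E\<close>. An element \<open>w\<close> vanishes in \<open>T \<otimes> N\<close> iff \<open>tensor_null E T N w\<close> generates the unit ideal of
  \<open>T\<close>. The factor \<open>e\<close> in its definition ensures that products of elements annihilating \<open>v\<close> and \<open>w\<close>
  annihilate \<open>v + w\<close>.
\<close>

definition tensor_eval ::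
    "'k::field set \<Rightarrow> 'k set \<Rightarrow> ('k, 'n, 'z) module_scheme \<Rightarrow> 'k \<Rightarrow> ('k \<times> 'n \<Rightarrow>\<^sub>0 int) \<Rightarrow> 'n" where
  "tensor_eval E T N a =
     (SOME h. h \<in> hom (free_Abelian_group (T \<times> carrier N)) (add_monoid N) \<and>
        (\<forall>t\<in>T. \<forall>n\<in>carrier N.
           h (frag_of (t, n)) = (if a * t \<in> E then (a * t) \<odot>\<^bsub>N\<^esub> n else \<zero>\<^bsub>N\<^esub>)))"

definition tensor_null ::
    "'k::field set \<Rightarrow> 'k set \<Rightarrow> ('k, 'n, 'z) module_scheme \<Rightarrow> ('k \<times> 'n \<Rightarrow>\<^sub>0 int) \<Rightarrow> 'k set" where
  "tensor_null E T N w = {a \<in> E. \<forall>e\<in>E. tensor_eval E T N (a * e) w = \<zero>\<^bsub>N\<^esub>}"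

context
  fixes E T :: "'k::field set" and N :: "('k, 'n, 'z) module_scheme"
  assumes E: "subrng E" and T: "T \<in> overrings E" and N: "Module.module (ring_on E) N"
begin

interpretation N: Module.module "ring_on E" N
  by (rule N)

text \<open>The universal property of the free abelian group provides a homomorphism with the
  prescribed values, so the choice in the definition succeeds.\<close>

lemma tensor_eval:
  shows "tensor_eval E T N a \<in> hom (free_Abelian_group (T \<times> carrier N)) (add_monoid N)"
    and "t \<in> T \<Longrightarrow> n \<in> carrier N \<Longrightarrow>
      tensor_eval E T N a (frag_of (t, n)) = (if a * t \<in> E then (a * t) \<odot>\<^bsub>N\<^esub> n else \<zero>\<^bsub>N\<^esub>)"
proof -
  let ?f = "\<lambda>(t, n). if a * t \<in> E then (a * t) \<odot>\<^bsub>N\<^esub> n else \<zero>\<^bsub>N\<^esub>"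
  have "?f ` (T \<times> carrier N) \<subseteq> carrier (add_monoid N)"
    by auto
  then obtain h where "h \<in> hom (free_Abelian_group (T \<times> carrier N)) (add_monoid N)"
    "\<And>p. p \<in> T \<times> carrier N \<Longrightarrow> h (frag_of p) = ?f p"
    using comm_group.free_Abelian_group_universal[OF N.a_comm_group] by blast
  then have "\<exists>h. h \<in> hom (free_Abelian_group (T \<times> carrier N)) (add_monoid N) \<and>
        (\<forall>t\<in>T. \<forall>n\<in>carrier N.
           h (frag_of (t, n)) = (if a * t \<in> E then (a * t) \<odot>\<^bsub>N\<^esub> n else \<zero>\<^bsub>N\<^esub>))"
    by (intro exI[of _ h]) auto
  from someI_ex[OF this]
  show "tensor_eval E T N a \<in> hom (free_Abelian_group (T \<times> carrier N)) (add_monoid N)"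
    "t \<in> T \<Longrightarrow> n \<in> carrier N \<Longrightarrow>
      tensor_eval E T N a (frag_of (t, n)) = (if a * t \<in> E then (a * t) \<odot>\<^bsub>N\<^esub> n else \<zero>\<^bsub>N\<^esub>)"
    unfolding tensor_eval_def by blast+
qed

lemma tensor_eval_hom:
  shows "tensor_eval E T N a 0 = \<zero>\<^bsub>N\<^esub>"
    and "Poly_Mapping.keys w \<subseteq> T \<times> carrier N \<Longrightarrow> tensor_eval E T N a w \<in> carrier N"
    and "Poly_Mapping.keys v \<subseteq> T \<times> carrier N \<Longrightarrow> Poly_Mapping.keys w \<subseteq> T \<times> carrier N \<Longrightarrow>
      tensor_eval E T N a (v + w) = tensor_eval E T N a v \<oplus>\<^bsub>N\<^esub> tensor_eval E T N a w"
    and "Poly_Mapping.keys w \<subseteq> T \<times> carrier N \<Longrightarrow>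
      tensor_eval E T N a (- w) = \<ominus>\<^bsub>N\<^esub> tensor_eval E T N a w"
    and "Poly_Mapping.keys v \<subseteq> T \<times> carrier N \<Longrightarrow> Poly_Mapping.keys w \<subseteq> T \<times> carrier N \<Longrightarrow>
      tensor_eval E T N a (v - w) = tensor_eval E T N a v \<ominus>\<^bsub>N\<^esub> tensor_eval E T N a w"
proof -
  interpret h: group_hom "free_Abelian_group (T \<times> carrier N)" "add_monoid N" "tensor_eval E T N a"
    using tensor_eval(1) N.a_group by (simp add: group_hom_def group_hom_axioms_def)
  show "tensor_eval E T N a 0 = \<zero>\<^bsub>N\<^esub>"
    using h.hom_one by simp
  show "tensor_eval E T N a w \<in> carrier N" if "Poly_Mapping.keys w \<subseteq> T \<times> carrier N"
    using h.hom_closed[of w] that by simp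
  show add: "tensor_eval E T N a (v + w) = tensor_eval E T N a v \<oplus>\<^bsub>N\<^esub> tensor_eval E T N a w"
    if "Poly_Mapping.keys v \<subseteq> T \<times> carrier N" "Poly_Mapping.keys w \<subseteq> T \<times> carrier N" for v w
    using h.hom_mult[of v w] that by simp
  show minus: "tensor_eval E T N a (- w) = \<ominus>\<^bsub>N\<^esub> tensor_eval E T N a w"
    if "Poly_Mapping.keys w \<subseteq> T \<times> carrier N" for w
    using h.hom_inv[of w] that by (simp add: a_inv_def)
  show "tensor_eval E T N a (v - w) = tensor_eval E T N a v \<ominus>\<^bsub>N\<^esub> tensor_eval E T N a w"
    if "Poly_Mapping.keys v \<subseteq> T \<times> carrier N" "Poly_Mapping.keys w \<subseteq> T \<times> carrier N"
    using add[OF that(1), of "- w"] minus[OF that(2)] that(2) by (simp add: a_minus_def)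
qed

text \<open>Elements whose null set generates the unit ideal form a subgroup, so it is enough to
  treat the relators. A relator vanishes under every \<open>a\<close> that clears the relevant first
  entries, and such \<open>a\<close> generate the unit ideal.\<close>

lemma tensor_kernel_imp_null:
  assumes flat: "conductor_flat E T" and w: "w \<in> tensor_kernel (ring_on E) (module_on T) N"
  shows "1 \<in> mult_span (tensor_null E T N w) T"
proof -
  let ?S = "T \<times> carrier N"
  define H where "H = {w. Poly_Mapping.keys w \<subseteq> ?S \<and> 1 \<in> mult_span (tensor_null E T N w) T}"
  have T': "subrng T" and ET: "E \<subseteq> T"
    using overringsD[OF T] by auto
  have "subgroup H (free_Abelian_group ?S)"
  proof (rule subgroup_free_Abelian_groupI)
    show "0 \<in> H"
      using tensor_eval_hom(1) subrngD(1)[OF E] T'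
      by (auto simp: H_def tensor_null_def intro: one_in_mult_span_self)
    show "- w \<in> H" if "w \<in> H" for w
    proof -
      have "tensor_null E T N w \<subseteq> tensor_null E T N (- w)"
        using that tensor_eval_hom(4) by (auto simp: H_def tensor_null_def)
      then show ?thesis
        using that by (auto simp: H_def elim: mult_span_mono)
    qed
    show "v + w \<in> H" if vw: "v \<in> H" "w \<in> H" for v w
    proof -
      have "a * b \<in> tensor_null E T N (v + w)"
        if "a \<in> tensor_null E T N v" "b \<in> tensor_null E T N w" for a b
      proof -
        have ab: "a \<in> E" "b \<in> E"
          using that by (auto simp: tensor_null_def)
        have "tensor_eval E T N (a * b * e) (v + w) = \<zero>\<^bsub>N\<^esub>" if e: "e \<in> E" for e
        proof -
          \<comment> \<open>\<open>a * b * e\<close> is read once as \<open>a * (b * e)\<close> and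
            once as \<open>b * (a * e)\<close>; the free factor in \<open>tensor_null\<close>
            absorbs the other element.\<close>
          have "tensor_eval E T N (a * (b * e)) v = \<zero>\<^bsub>N\<^esub>"
            using \<open>a \<in> tensor_null E T N v\<close> subrngD(6)[OF E ab(2) e] by (simp add: tensor_null_def)
          moreover have "tensor_eval E T N (b * (a * e)) w = \<zero>\<^bsub>N\<^esub>"
            using \<open>b \<in> tensor_null E T N w\<close> subrngD(6)[OF E ab(1) e] by (simp add: tensor_null_def)
          moreover have "a * (b * e) = a * b * e" "b * (a * e) = a * b * e"
            by (simp_all add: mult_ac)
          ultimately show ?thesis
            using vw tensor_eval_hom(3) by (simp add: H_def)
        qed
        then show ?thesis
          using subrngD(6)[OF E ab] by (simp add: tensor_null_def)
      qed
      moreover have "1 \<in> mult_span (tensor_null E T N v) T" "1 \<in> mult_span (tensor_null E T N w) T"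
        using vw by (simp_all add: H_def)
      ultimately have "1 \<in> mult_span (tensor_null E T N (v + w)) T"
        using one_in_mult_span_mult[OF _ _ T'] by metis
      then show ?thesis
        using vw keys_add[of v w] by (auto simp: H_def)
    qed
  qed (simp add: H_def)
  moreover have "tensor_relators (ring_on E) (module_on T) N \<subseteq> H"
  proof
    fix w assume w: "w \<in> tensor_relators (ring_on E) (module_on T) N"
    have "1 \<in> mult_span (tensor_null E T N w) T"
      if "finite P" "P \<subseteq> T" "\<And>a. a \<in> E \<Longrightarrow> \<forall>t\<in>P. a * t \<in> E \<Longrightarrow> tensor_eval E T N a w = \<zero>\<^bsub>N\<^esub>" for P
    proof -
      have "a * e * t \<in> E" if "a * t \<in> E" "e \<in> E" for a e t
        using subrngD(6)[OF E that] by (simp add: mult_ac)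
      then have "{a \<in> E. \<forall>t\<in>P. a * t \<in> E} \<subseteq> tensor_null E T N w"
        using that(3) subrngD(6)[OF E] by (auto simp: tensor_null_def)
      then show ?thesis
        using conductor_flat_finite[OF E T flat that(1,2)] by (auto elim: mult_span_mono)
    qed
    \<comment> \<open>\<open>P\<close> collects the first entries to be cleared. In the last kind of
      relator \<open>{x}\<close> is enough, since \<open>a * (r * x) = a * x * r\<close> lies in
      \<open>E\<close> together with \<open>a * x\<close>.\<close>
    moreover from w have "\<exists>P. finite P \<and> P \<subseteq> T \<and>
        (\<forall>a\<in>E. (\<forall>t\<in>P. a * t \<in> E) \<longrightarrow> tensor_eval E T N a w = \<zero>\<^bsub>N\<^esub>)"
      unfolding tensor_relators_def
    proof (elim UnE CollectE exE conjE)
      fix x y z assume w: "w = frag_of (x \<oplus>\<^bsub>module_on T\<^esub> y, z) - frag_of (x, z) - frag_of (y, z)"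
        and xyz: "x \<in> carrier (module_on T)" "y \<in> carrier (module_on T)" "z \<in> carrier N"
      have "tensor_eval E T N a w = \<zero>\<^bsub>N\<^esub>" if a: "a \<in> E" "a * x \<in> E" "a * y \<in> E" for a
      proof -
        have "a * x + a * y \<in> E"
          using a subrngD(4)[OF E] by blast
        then have "a * (x + y) \<in> E" "(a * (x + y)) \<odot>\<^bsub>N\<^esub> z = (a * x) \<odot>\<^bsub>N\<^esub> z \<oplus>\<^bsub>N\<^esub> (a * y) \<odot>\<^bsub>N\<^esub> z"
          using N.smult_l_distr[of "a * x" "a * y" z] a xyz by (simp_all add: distrib_left)
        moreover have "x + y \<in> T"
          using xyz subrngD(4)[OF T'] by simp
        ultimately show ?thesis
          using xyz a unfolding w
          by (simp add: tensor_eval_hom(5) tensor_eval(2) keys_frag_diff_subset N.add_minus_minus)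
      qed
      then show ?thesis
        using xyz by (intro exI[of _ "{x, y}"]) auto
    next
      fix x y z assume w: "w = frag_of (x, y \<oplus>\<^bsub>N\<^esub> z) - frag_of (x, y) - frag_of (x, z)"
        and xyz: "x \<in> carrier (module_on T)" "y \<in> carrier N" "z \<in> carrier N"
      have "tensor_eval E T N a w = \<zero>\<^bsub>N\<^esub>" if a: "a \<in> E" "a * x \<in> E" for a
        using xyz a N.smult_r_distr[of "a * x" y z] unfolding w
        by (simp add: tensor_eval_hom(5) tensor_eval(2) keys_frag_diff_subset N.add_minus_minus)
      then show ?thesis
        using xyz by (intro exI[of _ "{x}"]) auto
    next
      fix r x y assume w: "w = frag_of (r \<odot>\<^bsub>module_on T\<^esub> x, y) - frag_of (x, r \<odot>\<^bsub>N\<^esub> y)"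
        and xyz: "r \<in> carrier (ring_on E)" "x \<in> carrier (module_on T)" "y \<in> carrier N"
      have "tensor_eval E T N a w = \<zero>\<^bsub>N\<^esub>" if a: "a \<in> E" "a * x \<in> E" for a
      proof -
        have "a * x * r \<in> E"
          using a xyz subrngD(6)[OF E] by simp
        moreover have "(a * x * r) \<odot>\<^bsub>N\<^esub> y = (a * x) \<odot>\<^bsub>N\<^esub> (r \<odot>\<^bsub>N\<^esub> y)"
          using N.smult_assoc1[of "a * x" r y] a xyz by simp
        moreover have "a * x * r = a * (r * x)"
          by (simp add: mult_ac)
        moreover have "r * x \<in> T"
          using xyz ET subrngD(6)[OF T'] by auto
        ultimately show ?thesis
          using xyz a unfolding w
          by (simp add: tensor_eval_hom(5) tensor_eval(2)) (simp add: a_minus_def N.r_neg)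
      qed
      then show ?thesis
        using xyz by (intro exI[of _ "{x}"]) auto
    qed
    moreover have "Poly_Mapping.keys w \<subseteq> ?S"
      using subsetD[OF tensor_relators_subset[OF module_module_on[OF E T] N] w] by simp
    ultimately show "w \<in> H"
      by (auto simp: H_def)
  qed
  ultimately have "tensor_kernel (ring_on E) (module_on T) N \<subseteq> H"
    by (intro tensor_kernel_subset) simp_all
  then show ?thesis
    using w by (auto simp: H_def)
qed

text \<open>If \<open>a\<close> clears all first entries of \<open>w\<close>, then
  \<open>a w = 1 \<otimes> n\<close>, where \<open>n\<close> is the value of \<open>w\<close> under
  \<open>tensor_eval\<close>; if that value is zero, so is \<open>a w\<close>. Such \<open>a\<close>
  generate the unit ideal of \<open>T\<close>, hence \<open>1 w = w\<close> is zero as well.\<close>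

lemma null_imp_tensor_kernel:
  assumes flat: "conductor_flat E T" and w: "Poly_Mapping.keys w \<subseteq> T \<times> carrier N"
    and null: "1 \<in> mult_span (tensor_null E T N w) T"
  shows "w \<in> tensor_kernel (ring_on E) (module_on T) N"
proof -
  let ?S = "T \<times> carrier N"
  let ?K = "tensor_kernel (ring_on E) (module_on T) N"
  note rel = tensor_relatorI[where R = "ring_on E" and M = "module_on T" and N = N, simplified]
  note K = tensor_kernelD[OF module_module_on[OF E T] N]
  have T': "subrng T" and ET: "E \<subseteq> T"
    using overringsD[OF T] by auto
  \<comment> \<open>\<open>\<sigma> s\<close> multiplies the first tensor factor by \<open>s\<close>
    on formal sums. It is multiplicative in \<open>s\<close> exactly, but additive in
    \<open>s\<close> only modulo \<open>?K\<close>.\<close>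
  define \<sigma> where "\<sigma> s = frag_extend (\<lambda>(t, n :: 'n). frag_of (s * t, n))" for s :: 'k
  have \<sigma>_of [simp]: "\<sigma> s (frag_of (t, n)) = frag_of (s * t, n)" for s t n
    by (simp add: \<sigma>_def)
  have \<sigma>_diff [simp]: "\<sigma> s (u - v) = \<sigma> s u - \<sigma> s v" for s u v
    by (simp add: \<sigma>_def frag_extend_diff)
  have \<sigma>_0 [simp]: "\<sigma> s 0 = 0" for s
    by (simp add: \<sigma>_def)
  have \<sigma>_mult: "\<sigma> s (\<sigma> t w) = \<sigma> (s * t) w" for s t w
    using subset_UNIV[of "Poly_Mapping.keys w"]
    by (induction w rule: frag_induction) (auto simp: mult.assoc)
  have \<sigma>_1: "\<sigma> 1 w = w"
    using subset_UNIV[of "Poly_Mapping.keys w"]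
    by (induction w rule: frag_induction) auto
  have \<sigma>_add: "\<sigma> (s + t) w - \<sigma> s w - \<sigma> t w \<in> ?K" if "s \<in> T" "t \<in> T" for s t
    using w
  proof (induction w rule: frag_induction)
    case zero
    show ?case
      using K(1) by simp
  next
    case (one p)
    then obtain x n where "p = (x, n)" "x \<in> T" "n \<in> carrier N"
      by blast
    then show ?case
      using rel(1)[of "s * x" "t * x" n] that subrngD(6)[OF T'] by (simp add: distrib_right)
  next
    case (diff u v)
    have "\<sigma> (s + t) (u - v) - \<sigma> s (u - v) - \<sigma> t (u - v) =
        (\<sigma> (s + t) u - \<sigma> s u - \<sigma> t u) - (\<sigma> (s + t) v - \<sigma> s v - \<sigma> t v)"
      by simp
    then show ?case
      using K(5)[OF diff] by (simp only:)
  qed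
  have \<sigma>_K: "\<sigma> s u \<in> ?K" if s: "s \<in> T" and u: "u \<in> ?K" for s u
  proof -
    let ?H = "{u. Poly_Mapping.keys u \<subseteq> ?S \<and> \<sigma> s u \<in> ?K}"
    have H: "subgroup ?H (free_Abelian_group ?S)"
    proof (rule subgroup_free_Abelian_groupI)
      show "u + v \<in> ?H" if "u \<in> ?H" "v \<in> ?H" for u v
        using that K(4) keys_add[of u v] by (auto simp: \<sigma>_def frag_extend_add)
      show "- u \<in> ?H" if "u \<in> ?H" for u
        using that K(3) by (auto simp: \<sigma>_def frag_extend_minus)
    qed (use K(1) in auto)
    have "\<sigma> s u \<in> ?K" if "u \<in> tensor_relators (ring_on E) (module_on T) N" for u
      using that unfolding tensor_relators_def
    proof (elim UnE CollectE exE conjE)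
      fix x y z assume "u = frag_of (x \<oplus>\<^bsub>module_on T\<^esub> y, z) - frag_of (x, z) - frag_of (y, z)"
        "x \<in> carrier (module_on T)" "y \<in> carrier (module_on T)" "z \<in> carrier N"
      then show ?thesis
        using rel(1)[of "s * x" "s * y" z] s subrngD(6)[OF T'] by (simp add: distrib_left)
    next
      fix x y z assume "u = frag_of (x, y \<oplus>\<^bsub>N\<^esub> z) - frag_of (x, y) - frag_of (x, z)"
        "x \<in> carrier (module_on T)" "y \<in> carrier N" "z \<in> carrier N"
      then show ?thesis
        using rel(2)[of "s * x" y z] s subrngD(6)[OF T'] by simp
    next
      fix r x y assume u: "u = frag_of (r \<odot>\<^bsub>module_on T\<^esub> x, y) - frag_of (x, r \<odot>\<^bsub>N\<^esub> y)"
        and xy: "r \<in> carrier (ring_on E)" "x \<in> carrier (module_on T)" "y \<in> carrier N"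
      have "\<sigma> s u = frag_of (r * (s * x), y) - frag_of (s * x, r \<odot>\<^bsub>N\<^esub> y)"
        by (simp add: u mult.left_commute)
      then show ?thesis
        using rel(3)[of r "s * x" y] s subrngD(6)[OF T'] xy by simp
    qed
    moreover have "Poly_Mapping.keys u \<subseteq> ?S"
      if "u \<in> tensor_relators (ring_on E) (module_on T) N" for u
      using subsetD[OF tensor_relators_subset[OF module_module_on[OF E T] N] that] by simp
    ultimately have "tensor_relators (ring_on E) (module_on T) N \<subseteq> ?H"
      by blast
    then have "?K \<subseteq> ?H"
      using H by (intro tensor_kernel_subset) simp_all
    then show ?thesis
      using u by blast
  qed
  have one_T: "1 \<in> T"
    using subrngD(1)[OF T'] .
  \<comment> \<open>With both second entries zero, the additivity relator is the negative of this
    element.\<close>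
  have frag_0: "frag_of (1, \<zero>\<^bsub>N\<^esub>) \<in> ?K"
    using K(3)[OF rel(2)[OF one_T N.zero_closed N.zero_closed]] by simp
  \<comment> \<open>Each \<open>a * t\<close> lies in \<open>E\<close> here and moves across the
    tensor sign, leaving \<open>1\<close> on the left.\<close>
  have \<sigma>_eval: "\<sigma> a w - frag_of (1, tensor_eval E T N a w) \<in> ?K"
    if a: "a \<in> E" "\<forall>p\<in>Poly_Mapping.keys w. a * fst p \<in> E" for a
  proof -
    let ?S' = "{p \<in> ?S. a * fst p \<in> E}"
    have "Poly_Mapping.keys w \<subseteq> ?S'"
      using w a(2) by auto
    then have "Poly_Mapping.keys w \<subseteq> ?S \<and> \<sigma> a w - frag_of (1, tensor_eval E T N a w) \<in> ?K"
    proof (induction w rule: frag_induction)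
      case zero
      show ?case
        using K(3)[OF frag_0] tensor_eval_hom(1) by simp
    next
      case (one p)
      then obtain t n where "p = (t, n)" "t \<in> T" "n \<in> carrier N" "a * t \<in> E"
        by auto
      then show ?case
        using rel(3)[of "a * t" 1 n] one_T tensor_eval(2) by simp
    next
      case (diff u v)
      define x y where "x = tensor_eval E T N a u" and "y = tensor_eval E T N a v"
      have xy: "x \<in> carrier N" "y \<in> carrier N"
        using diff tensor_eval_hom(2) by (auto simp: x_def y_def)
      have "x \<ominus>\<^bsub>N\<^esub> y \<oplus>\<^bsub>N\<^esub> y = x"
        using xy by (simp add: a_minus_def N.a_assoc N.l_neg)
      then have "frag_of (1, x) - frag_of (1, x \<ominus>\<^bsub>N\<^esub> y) - frag_of (1, y) \<in> ?K"
        using rel(2)[OF one_T N.minus_closed[OF xy] xy(2)] by simp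
      from K(4)[OF K(5) this, of "\<sigma> a u - frag_of (1, x)" "\<sigma> a v - frag_of (1, y)"]
      have "\<sigma> a (u - v) - frag_of (1, x \<ominus>\<^bsub>N\<^esub> y) \<in> ?K"
        using diff by (simp add: x_def y_def algebra_simps)
      then show ?case
        using diff tensor_eval_hom(5) by (simp add: x_def y_def keys_frag_diff_subset)
    qed
    then show ?thesis by blast
  qed
  have "1 \<in> mult_span {a \<in> E. \<forall>t\<in>fst ` Poly_Mapping.keys w. a * t \<in> E} T"
    using w by (intro conductor_flat_finite[OF E T flat]) auto
  from null this T'
  have "1 \<in> mult_span {a \<in> E. \<sigma> a w \<in> ?K} T"
  proof (rule one_in_mult_span_mult)
    fix a b assume a: "a \<in> tensor_null E T N w"
      and b: "b \<in> {a \<in> E. \<forall>t\<in>fst ` Poly_Mapping.keys w. a * t \<in> E}"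
    have ab: "a * b \<in> E" "tensor_eval E T N (a * b) w = \<zero>\<^bsub>N\<^esub>"
      using a b subrngD(6)[OF E] by (auto simp: tensor_null_def)
    have "a * b * fst p \<in> E" if "p \<in> Poly_Mapping.keys w" for p
      using a b that subrngD(6)[OF E, of a "b * fst p"] by (auto simp: tensor_null_def mult.assoc)
    then have "\<sigma> (a * b) w \<in> ?K"
      using K(4)[OF \<sigma>_eval[OF ab(1)] frag_0] ab(2) by simp
    then show "a * b \<in> {a \<in> E. \<sigma> a w \<in> ?K}"
      using ab(1) by simp
  qed
  \<comment> \<open>Induction along a sum for \<open>1\<close>. Membership of the partial sums in
    \<open>T\<close> is carried along because \<open>\<sigma>_add\<close> asks for it.\<close>
  then have "1 \<in> T \<and> \<sigma> 1 w \<in> ?K"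
  proof induction
    \<comment> \<open>Additivity at \<open>0 + 0\<close> says that \<open>- \<sigma> 0 w\<close>
      lies in \<open>?K\<close>.\<close>
    case zero
    show ?case
      using \<sigma>_add[of 0 0] K(3)[of "- \<sigma> 0 w"] subrngD(2)[OF T'] by simp
  next
    case (step a t x)
    then have "a * t \<in> T" "\<sigma> (a * t) w \<in> ?K"
      using \<sigma>_K[of t "\<sigma> a w"] ET subrngD(6)[OF T'] by (auto simp: \<sigma>_mult mult.commute)
    moreover have "\<sigma> (a * t + x) w = (\<sigma> (a * t + x) w - \<sigma> (a * t) w - \<sigma> x w) + (\<sigma> (a * t) w + \<sigma> x w)"
      by simp
    ultimately show ?case
      using step.IH \<sigma>_add[of "a * t" x] K(4) subrngD(4)[OF T'] by metis
  qed
  then show ?thesis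
    by (simp add: \<sigma>_1)
qed

end

lemma r_coset_free_Abelian_group_eq_iff:
  assumes "0 \<in> K" "\<And>v w. v \<in> K \<Longrightarrow> w \<in> K \<Longrightarrow> v + w \<in> K" "\<And>w. w \<in> K \<Longrightarrow> - w \<in> K"
  shows "K #>\<^bsub>free_Abelian_group S\<^esub> v = K #>\<^bsub>free_Abelian_group S\<^esub> w \<longleftrightarrow> v - w \<in> K"
proof -
  have coset: "K #>\<^bsub>free_Abelian_group S\<^esub> v = (\<lambda>k. k + v) ` K" for v
    by (auto simp: r_coset_def)
  have sub: "(\<lambda>k. k + v) ` K \<subseteq> (\<lambda>k. k + w) ` K" if "v - w \<in> K" for v w
  proof
    fix z assume "z \<in> (\<lambda>k. k + v) ` K"
    then obtain k where "k \<in> K" "z = k + v"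
      by blast
    then have "z = (k + (v - w)) + w" "k + (v - w) \<in> K"
      using assms(2) that by simp_all
    then show "z \<in> (\<lambda>k. k + w) ` K"
      by blast
  qed
  show ?thesis
    unfolding coset
  proof
    assume "(\<lambda>k. k + v) ` K = (\<lambda>k. k + w) ` K"
    moreover have "v \<in> (\<lambda>k. k + v) ` K"
      using assms(1) by (intro image_eqI[of _ _ 0]) simp_all
    ultimately obtain k where "k \<in> K" "v = k + w"
      by blast
    then show "v - w \<in> K"
      by simp
  next
    assume "v - w \<in> K"
    moreover from this have "w - v \<in> K"
      using assms(3)[of "v - w"] by simp
    ultimately show "(\<lambda>k. k + v) ` K = (\<lambda>k. k + w) ` K"
      using sub by blast
  qed
qed

lemma pure_tensor_eq_iff:
  assumes "Module.module R M" "Module.module R N"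
  shows "pure_tensor R M N x y = pure_tensor R M N x' y' \<longleftrightarrow>
    frag_of (x, y) - frag_of (x', y') \<in> tensor_kernel R M N"
  unfolding pure_tensor_def
  by (intro r_coset_free_Abelian_group_eq_iff tensor_kernelD[OF assms])

section \<open>The conductor criterion implies flatness\<close>

text \<open>Evaluation commutes with \<open>f\<close>, and \<open>f\<close> is injective, so a
  formal sum and its image have the same null set. By the zero criterion one is zero in its tensor
  product exactly when the other is.\<close>

lemma conductor_flat_imp_flat_module:
  assumes E: "subrng E" and T: "T \<in> overrings E" and flat: "conductor_flat E T"
  shows "flat_module (ring_on E) (module_on T)"
  unfolding flat_module_def
proof (intro conjI allI impI; (elim conjE)?)
  show M: "Module.module (ring_on E) (module_on T)"
    using E T by (rule module_module_on)
  fix N N' :: "('a, (nat \<Rightarrow> 'a) set) module" and f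
  assume N: "Module.module (ring_on E) N" and N': "Module.module (ring_on E) N'"
    and f: "f \<in> linear_maps (ring_on E) N N'" and inj: "inj_on f (carrier N)"
  interpret N: Module.module "ring_on E" N by (rule N)
  interpret N': Module.module "ring_on E" N' by (rule N')
  let ?S = "T \<times> carrier N" and ?S' = "T \<times> carrier N'"
  let ?K = "tensor_kernel (ring_on E) (module_on T) N"
  let ?K' = "tensor_kernel (ring_on E) (module_on T) N'"
  note K' = tensor_kernelD[OF M N']
  have f_hom: "f \<in> hom (add_monoid N) (add_monoid N')"
    and f_smult: "\<And>r y. r \<in> E \<Longrightarrow> y \<in> carrier N \<Longrightarrow> f (r \<odot>\<^bsub>N\<^esub> y) = r \<odot>\<^bsub>N'\<^esub> f y"
    using f by (auto simp: linear_maps_def)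
  interpret f: group_hom "add_monoid N" "add_monoid N'" f
    using f_hom N.a_group N'.a_group by (simp add: group_hom_def group_hom_axioms_def)
  have f_closed: "f y \<in> carrier N'" if "y \<in> carrier N" for y
    using f.hom_closed that by simp
  have f_zero: "f \<zero>\<^bsub>N\<^esub> = \<zero>\<^bsub>N'\<^esub>"
    using f.hom_one by simp
  have f_minus: "f (y \<ominus>\<^bsub>N\<^esub> z) = f y \<ominus>\<^bsub>N'\<^esub> f z" if "y \<in> carrier N" "z \<in> carrier N" for y z
    using f.hom_mult[of y "\<ominus>\<^bsub>N\<^esub> z"] f.hom_inv[of z] that by (simp add: a_minus_def a_inv_def)
  have f_eq_zero: "y = \<zero>\<^bsub>N\<^esub>" if "y \<in> carrier N" "f y = \<zero>\<^bsub>N'\<^esub>" for y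
    using inj that f_zero by (auto dest: inj_onD)
  define \<phi> where "\<phi> = frag_extend (\<lambda>(t :: 'a, n). frag_of (t, f n))"
  have \<phi>_keys: "Poly_Mapping.keys (\<phi> w) \<subseteq> ?S'" if "Poly_Mapping.keys w \<subseteq> ?S" for w
  proof
    fix p assume "p \<in> Poly_Mapping.keys (\<phi> w)"
    from subsetD[OF keys_frag_extend this[unfolded \<phi>_def]]
    obtain t n where "(t, n) \<in> Poly_Mapping.keys w" "p = (t, f n)"
      by (auto simp: keys_frag_of)
    then show "p \<in> ?S'"
      using that f_closed by auto
  qed
  have \<phi>_eval: "tensor_eval E T N' a (\<phi> w) = f (tensor_eval E T N a w)"
    if "Poly_Mapping.keys w \<subseteq> ?S" for a w
  proof -
    note ev = tensor_eval[OF E T N] tensor_eval_hom[OF E T N]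
    note ev' = tensor_eval[OF E T N'] tensor_eval_hom[OF E T N']
    have "Poly_Mapping.keys w \<subseteq> ?S \<and> tensor_eval E T N' a (\<phi> w) = f (tensor_eval E T N a w)"
      using that
    proof (induction w rule: frag_induction)
      case zero
      show ?case
        by (simp add: \<phi>_def ev(3) ev'(3) f_zero)
    next
      case (one p)
      then obtain t n where "p = (t, n)" "t \<in> T" "n \<in> carrier N"
        by blast
      then show ?case
        by (simp add: \<phi>_def ev(2) ev'(2) f_zero f_smult f_closed)
    next
      case (diff u v)
      have "\<phi> (u - v) = \<phi> u - \<phi> v"
        by (simp add: \<phi>_def frag_extend_diff)
      then show ?case
        using diff ev(4,7) ev'(7) \<phi>_keys f_minus by (simp add: keys_frag_diff_subset)
    qed
    then show ?thesis by blast
  qed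
  \<comment> \<open>One direction makes the induced map well defined, the other makes it
    injective.\<close>
  have \<phi>_K: "\<phi> w \<in> ?K' \<longleftrightarrow> w \<in> ?K" if w: "Poly_Mapping.keys w \<subseteq> ?S" for w
  proof -
    have "f (tensor_eval E T N a w) = \<zero>\<^bsub>N'\<^esub> \<longleftrightarrow> tensor_eval E T N a w = \<zero>\<^bsub>N\<^esub>" for a
      using f_eq_zero f_zero tensor_eval_hom(2)[OF E T N w] by metis
    then have "tensor_null E T N' (\<phi> w) = tensor_null E T N w"
      using \<phi>_eval[OF w] by (simp add: tensor_null_def)
    then show ?thesis
      using tensor_kernel_imp_null[OF E T N flat] null_imp_tensor_kernel[OF E T N flat w]
        tensor_kernel_imp_null[OF E T N' flat] null_imp_tensor_kernel[OF E T N' flat \<phi>_keys[OF w]]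
      by metis
  qed
  define \<psi> where "\<psi> w = ?K' #>\<^bsub>free_Abelian_group ?S'\<^esub> \<phi> w" for w
  have normal: "?K' \<lhd> free_Abelian_group ?S'"
    using subgroup_tensor_kernel[OF M N']
    by (intro iffD2[OF comm_group.normal_iff_subgroup[OF abelian_free_Abelian_group]]) simp
  have "\<phi> \<in> hom (free_Abelian_group ?S) (free_Abelian_group ?S')"
    by (rule homI) (use \<phi>_keys in \<open>auto simp: \<phi>_def frag_extend_add\<close>)
  then have "(\<lambda>w. ?K' #>\<^bsub>free_Abelian_group ?S'\<^esub> w) \<circ> \<phi> \<in>
      hom (free_Abelian_group ?S) (free_Abelian_group ?S' Mod ?K')"
    using normal.r_coset_hom_Mod[OF normal] by (rule hom_compose)
  then have "\<psi> \<in> hom (free_Abelian_group ?S) (tensor_product (ring_on E) (module_on T) N')"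
    by (simp add: \<psi>_def[abs_def] comp_def tensor_product_def)
  moreover have "group (tensor_product (ring_on E) (module_on T) N')"
    unfolding tensor_product_def using normal.factorgroup_is_group[OF normal] by simp
  ultimately interpret \<psi>: group_hom "free_Abelian_group ?S"
    "tensor_product (ring_on E) (module_on T) N'" \<psi>
    by (simp add: group_hom_def group_hom_axioms_def)
  have "\<psi> w = \<one>\<^bsub>tensor_product (ring_on E) (module_on T) N'\<^esub> \<longleftrightarrow> \<phi> w \<in> ?K'" for w
  proof -
    have "?K' = ?K' #>\<^bsub>free_Abelian_group ?S'\<^esub> 0"
      by (simp add: r_coset_def)
    then have "\<one>\<^bsub>tensor_product (ring_on E) (module_on T) N'\<^esub> = ?K' #>\<^bsub>free_Abelian_group ?S'\<^esub> 0"
      by (simp add: tensor_product_def)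
    then show ?thesis
      using r_coset_free_Abelian_group_eq_iff[OF K'(1,4,3), of ?S' "\<phi> w" 0] by (simp add: \<psi>_def)
  qed
  moreover have "Poly_Mapping.keys w \<subseteq> ?S" if "w \<in> ?K" for w
    using tensor_kernelD(2)[OF M N that] by simp
  \<comment> \<open>Since the kernel of \<open>\<psi>\<close> is exactly \<open>?K\<close>, the
    first isomorphism theorem yields the required injective map on the quotient.\<close>
  ultimately have ker: "kernel (free_Abelian_group ?S)
      (tensor_product (ring_on E) (module_on T) N') \<psi> = ?K"
    using \<phi>_K by (auto simp: kernel_def)
  have ten: "free_Abelian_group ?S Mod ?K = tensor_product (ring_on E) (module_on T) N"
    by (simp add: tensor_product_def)
  show "\<exists>h\<in>mon (tensor_product (ring_on E) (module_on T) N)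
      (tensor_product (ring_on E) (module_on T) N').
      \<forall>x\<in>carrier (module_on T). \<forall>y\<in>carrier N.
        h (pure_tensor (ring_on E) (module_on T) N x y) = pure_tensor (ring_on E) (module_on T) N' x (f y)"
  proof (intro bexI ballI)
    show "(\<lambda>X. the_elem (\<psi> ` X)) \<in> mon (tensor_product (ring_on E) (module_on T) N)
        (tensor_product (ring_on E) (module_on T) N')"
      using \<psi>.FactGroup_hom \<psi>.FactGroup_inj_on unfolding ker ten by (simp add: mon_def)
    fix x y assume xy: "x \<in> carrier (module_on T)" "y \<in> carrier N"
    let ?w = "frag_of (x, y)"
    have w: "?w \<in> carrier (free_Abelian_group ?S)"
      using xy by simp
    have "\<psi> ` (?K #>\<^bsub>free_Abelian_group ?S\<^esub> ?w) = {\<psi> ?w}"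
    proof -
      have "\<psi> (k + ?w) = \<psi> ?w" if k: "k \<in> ?K" for k
      proof -
        have "k \<in> carrier (free_Abelian_group ?S)"
          "\<psi> k = \<one>\<^bsub>tensor_product (ring_on E) (module_on T) N'\<^esub>"
          using k unfolding ker[symmetric] kernel_def by auto
        then show ?thesis
          using \<psi>.hom_mult[of k ?w] w \<psi>.hom_closed[OF w] by (metis \<psi>.H.l_one mult_free_Abelian_group)
      qed
      then show ?thesis
        using tensor_kernelD(1)[OF M N] by (auto simp: r_coset_def intro!: image_eqI)
    qed
    moreover have "\<psi> ?w = pure_tensor (ring_on E) (module_on T) N' x (f y)"
      by (simp add: \<psi>_def \<phi>_def pure_tensor_def)
    ultimately show "the_elem (\<psi> ` pure_tensor (ring_on E) (module_on T) N x y) =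
        pure_tensor (ring_on E) (module_on T) N' x (f y)"
      by (simp add: pure_tensor_def)
  qed
qed

section \<open>Flatness implies the conductor criterion\<close>

text \<open>Places a copy of \<open>K\<close> in the type \<open>(nat \<Rightarrow> 'k) set\<close>
  from which \<open>flat_module\<close> takes its test modules.\<close>

definition encode :: "'k \<Rightarrow> (nat \<Rightarrow> 'k) set" where
  "encode x = {\<lambda>_. x}"

definition decode :: "(nat \<Rightarrow> 'k) set \<Rightarrow> 'k" where
  "decode X = the_elem X 0"

text \<open>The ring multiplication and unit of the record play no role for modules.\<close>

definition encoded_module :: "'k::field set \<Rightarrow> ('k, (nat \<Rightarrow> 'k) set) module" where
  "encoded_module S = \<lparr>carrier = encode ` S, monoid.mult = (\<lambda>X Y. X), one = {},
     ring.zero = encode 0, add = (\<lambda>X Y. encode (decode X + decode Y)),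
     smult = (\<lambda>r X. encode (r * decode X))\<rparr>"

lemma decode_encode [simp]: "decode (encode x) = x"
  by (simp add: decode_def encode_def)

lemma encoded_module_simps [simp]:
  "carrier (encoded_module S) = encode ` S"
  "X \<oplus>\<^bsub>encoded_module S\<^esub> Y = encode (decode X + decode Y)"
  "\<zero>\<^bsub>encoded_module S\<^esub> = encode 0"
  "r \<odot>\<^bsub>encoded_module S\<^esub> X = encode (r * decode X)"
  by (simp_all add: encoded_module_def)

lemma module_encoded_module:
  assumes E: "subrng E" and S: "0 \<in> S" "\<And>x y. x \<in> S \<Longrightarrow> y \<in> S \<Longrightarrow> x + y \<in> S"
    "\<And>r x. r \<in> E \<Longrightarrow> x \<in> S \<Longrightarrow> r * x \<in> S"
  shows "Module.module (ring_on E) (encoded_module S)"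
proof (rule moduleI)
  show "cring (ring_on E)"
    using E by (rule cring_ring_on)
  show "abelian_group (encoded_module S)"
  proof (rule abelian_groupI)
    fix X assume "X \<in> carrier (encoded_module S)"
    then obtain x where x: "x \<in> S" "X = encode x"
      by auto
    then have "- x \<in> S"
      using S(3)[of "- 1" x] subrngD(1,3)[OF E] by auto
    then show "\<exists>Y\<in>carrier (encoded_module S). Y \<oplus>\<^bsub>encoded_module S\<^esub> X = \<zero>\<^bsub>encoded_module S\<^esub>"
      using x by (intro bexI[of _ "encode (- x)"]) simp_all
  qed (auto simp: S add_ac)
qed (auto simp: S distrib_left distrib_right mult.assoc)

text \<open>
  Write \<open>x = a / b\<close> and test flatness on \<open>J = (a, b) \<subseteq> E\<close>: from \<open>x \<otimes> b = 1 \<otimes> a\<close> in \<open>T \<otimes> E\<close> the same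
  holds in \<open>T \<otimes> J\<close>. The coefficient \<open>v\<close> of \<open>b u + a v \<in> J\<close> is unique modulo \<open>(E : x)\<close>, so
  \<open>t \<otimes> (b u + a v) \<mapsto> t v\<close> is a map \<open>T \<otimes> J \<rightarrow> T / (E : x) T\<close> sending \<open>x \<otimes> b\<close> to \<open>0\<close> and \<open>1 \<otimes> a\<close> to \<open>1\<close>.
\<close>

lemma flat_module_imp_conductor_flat:
  fixes E T :: "'k::field set"
  assumes dom: "domain_with_quotient_field E" and T: "T \<in> overrings E"
    and flat: "flat_module (ring_on E) (module_on T)"
  shows "conductor_flat E T"
  unfolding conductor_flat_def
proof
  fix x assume x: "x \<in> T"
  note E = dwqfD(1)[OF dom] and T' = overringsD(1)[OF T] and ET = overringsD(2)[OF T]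
  note E' = subrngD[OF E]
  obtain a b where ab: "a \<in> E" "b \<in> E" "b \<noteq> 0" "x = a / b"
    using dwqfD(2)[OF dom, of x] by blast
  then have bx: "b * x = a"
    by simp
  define J where "J = {b * u + a * v | u v. u \<in> E \<and> v \<in> E}"
  define I where "I = conductor E E x"
  define M where "M = mult_span I T"
  \<comment> \<open>\<open>g\<close> picks a coefficient of \<open>a\<close>. Only its class modulo
    \<open>I\<close> is determined, so \<open>g\<close> is linear up to elements of
    \<open>I\<close>.\<close>
  define g where "g j = (SOME v. v \<in> E \<and> (\<exists>u\<in>E. j = b * u + a * v))" for j
  let ?N = "encoded_module J" and ?N' = "encoded_module E"
  have JI: "b * u + a * v \<in> J" if "u \<in> E" "v \<in> E" for u v
    using that by (auto simp: J_def)
  have J_E: "J \<subseteq> E"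
    using ab E' by (auto simp: J_def)
  have "0 \<in> J"
    using JI[OF E'(2) E'(2)] by simp
  moreover have J_add: "i + j \<in> J" if ij: "i \<in> J" "j \<in> J" for i j
  proof -
    obtain u v u' v' where "i = b * u + a * v" "j = b * u' + a * v'" "u \<in> E" "v \<in> E" "u' \<in> E" "v' \<in> E"
      using ij by (auto simp: J_def)
    then show ?thesis
      using JI[of "u + u'" "v + v'"] E'(4) by (simp add: algebra_simps)
  qed
  moreover have J_mult: "r * j \<in> J" if rj: "r \<in> E" "j \<in> J" for r j
  proof -
    obtain u v where "j = b * u + a * v" "u \<in> E" "v \<in> E"
      using rj by (auto simp: J_def)
    then show ?thesis
      using JI[of "r * u" "r * v"] E'(6) rj(1) by (simp add: algebra_simps)
  qed
  ultimately have N: "Module.module (ring_on E) ?N"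
    by (intro module_encoded_module[OF E])
  have N': "Module.module (ring_on E) ?N'"
    using E' by (intro module_encoded_module[OF E])
  have Mod: "Module.module (ring_on E) (module_on T)"
    using E T by (rule module_module_on)
  have I: "ideal_on E I"
    unfolding I_def using E by (rule ideal_on_conductor) (use E' in \<open>auto simp: ideal_on_def\<close>)
  have I_M: "i * t \<in> M" if "i \<in> I" "t \<in> T" for i t
    using that by (simp add: M_def mult_span_mult)
  have M_add: "u + v \<in> M" if "u \<in> M" "v \<in> M" for u v
    using that by (simp add: M_def mult_span_add)
  have M_scale: "t * u \<in> M" if "t \<in> T" "u \<in> M" for t u
    using that subrngD(6)[OF T'] by (auto simp: M_def intro: mult_span_scale)
  have M_minus: "- u \<in> M" if "u \<in> M" for u
    using M_scale[of "- 1" u] that subrngD(1,3)[OF T'] by simp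
  have M_0: "0 \<in> M"
    by (simp add: M_def mult_span.zero)
  \<comment> \<open>Comparing two representations of \<open>j\<close> gives
    \<open>(g j - v) * x = u - u'\<close> in \<open>E\<close>, which is membership in
    \<open>I = (E : x)\<close>.\<close>
  have g: "g j - v \<in> I" "g j \<in> E" if "j = b * u + a * v" "u \<in> E" "v \<in> E" for j u v
  proof -
    have "g j \<in> E \<and> (\<exists>u'\<in>E. j = b * u' + a * g j)"
      unfolding g_def by (rule someI[of _ v]) (use that in blast)
    then obtain u' where u': "g j \<in> E" "u' \<in> E" "j = b * u' + a * g j"
      by blast
    have "b * ((g j - v) * x) = a * g j - a * v"
      by (simp add: algebra_simps flip: bx)
    also have "\<dots> = b * (u - u')"
      using u'(3) that(1) by (simp add: algebra_simps)
    finally have "(g j - v) * x = u - u'"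
      using ab(3) by simp
    then show "g j - v \<in> I" "g j \<in> E"
      using u' that E'(5) by (auto simp: I_def conductor_def)
  qed
  have g_E: "g j \<in> E" if "j \<in> J" for j
    using that g(2) by (auto simp: J_def)
  have g_add: "g (i + j) - (g i + g j) \<in> I" if ij: "i \<in> J" "j \<in> J" for i j
  proof -
    obtain u v u' v' where uv: "i = b * u + a * v" "j = b * u' + a * v'"
      "u \<in> E" "v \<in> E" "u' \<in> E" "v' \<in> E"
      using ij by (auto simp: J_def)
    have "i + j = b * (u + u') + a * (v + v')"
      using uv by (simp add: algebra_simps)
    from g(1)[OF this] have 1: "g (i + j) - (v + v') \<in> I"
      using uv E'(4) by simp
    have "- 1 * (g i - v) \<in> I" "- 1 * (g j - v') \<in> I"
      using g(1)[OF uv(1)] g(1)[OF uv(2)] uv E'(1,3) ideal_onD(4)[OF I] by blast+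
    with 1 have "g (i + j) - (v + v') + (- 1 * (g i - v) + - 1 * (g j - v')) \<in> I"
      using ideal_onD(3)[OF I] by blast
    then show ?thesis
      by (simp add: algebra_simps)
  qed
  have g_mult: "g (r * j) - r * g j \<in> I" if rj: "r \<in> E" "j \<in> J" for r j
  proof -
    obtain u v where uv: "j = b * u + a * v" "u \<in> E" "v \<in> E"
      using rj by (auto simp: J_def)
    have "r * j = b * (r * u) + a * (r * v)"
      using uv by (simp add: algebra_simps)
    from g(1)[OF this] have 1: "g (r * j) - r * v \<in> I"
      using uv E'(6) rj(1) by simp
    have "- r * (g j - v) \<in> I"
      using g(1)[OF uv] rj(1) E'(3) ideal_onD(4)[OF I] by blast
    with 1 have "g (r * j) - r * v + - r * (g j - v) \<in> I"
      using ideal_onD(3)[OF I] by blast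
    then show ?thesis
      by (simp add: algebra_simps)
  qed
  \<comment> \<open>The injection tested is the inclusion of \<open>J\<close> into
    \<open>E\<close>.\<close>
  have "(\<lambda>X. X) \<in> linear_maps (ring_on E) ?N ?N'"
    using J_E by (auto simp: linear_maps_def hom_def)
  then obtain h where h: "h \<in> mon (tensor_product (ring_on E) (module_on T) ?N)
        (tensor_product (ring_on E) (module_on T) ?N')"
      and h_pure: "\<And>s y. s \<in> T \<Longrightarrow> y \<in> J \<Longrightarrow> h (pure_tensor (ring_on E) (module_on T) ?N s (encode y)) =
        pure_tensor (ring_on E) (module_on T) ?N' s (encode y)"
    using flat N N' unfolding flat_module_def by (fastforce simp: inj_on_def)
  note K' = tensor_kernelD[OF Mod N']
  have rel: "frag_of (r * s, encode y) - frag_of (s, encode (r * y)) \<in>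
      tensor_kernel (ring_on E) (module_on T) ?N'" if "r \<in> E" "s \<in> T" "y \<in> E" for r s y
    using tensor_relatorI(3)[of r "ring_on E" s "module_on T" "encode y" ?N'] that by simp
  have one: "1 \<in> E" "1 \<in> T"
    using E'(1) subrngD(1)[OF T'] by auto
  \<comment> \<open>In \<open>T \<otimes> E\<close> the second factor can be reduced to
    \<open>1\<close>: \<open>x \<otimes> b = b x \<otimes> 1 = a \<otimes> 1 = 1 \<otimes>
    a\<close>.\<close>
  have "frag_of (x, encode b) - frag_of (1, encode a) \<in> tensor_kernel (ring_on E) (module_on T) ?N'"
    using K'(5)[OF rel[OF ab(1) one(2,1)] rel[OF ab(2) x one(1)]] bx by simp
  then have eq': "pure_tensor (ring_on E) (module_on T) ?N' x (encode b) =
      pure_tensor (ring_on E) (module_on T) ?N' 1 (encode a)"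
    by (simp add: pure_tensor_eq_iff[OF Mod N'])
  have ab_J: "a \<in> J" "b \<in> J"
    using JI[OF E'(2,1)] JI[OF E'(1,2)] by simp_all
  have carr: "pure_tensor (ring_on E) (module_on T) ?N s (encode y) \<in>
      carrier (tensor_product (ring_on E) (module_on T) ?N)" if "s \<in> T" "y \<in> J" for s y
    using that by (auto simp: pure_tensor_def tensor_product_def carrier_FactGroup intro!: imageI)
  have "pure_tensor (ring_on E) (module_on T) ?N x (encode b) =
      pure_tensor (ring_on E) (module_on T) ?N 1 (encode a)"
  proof (rule inj_onD)
    show "inj_on h (carrier (tensor_product (ring_on E) (module_on T) ?N))"
      using h by (simp add: mon_def)
  qed (use eq' h_pure x one ab_J carr in simp_all)
  then have ker: "frag_of (x, encode b) - frag_of (1, encode a) \<in> tensor_kernel (ring_on E) (module_on T) ?N"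
    by (simp add: pure_tensor_eq_iff[OF Mod N])
  interpret add: comm_group "add_monoid (ring_on (UNIV :: 'k set))"
    using cring_ring_on_UNIV abelian_group.a_comm_group cring.axioms(1) ring.is_abelian_group by metis
  let ?S = "T \<times> encode ` J"
  \<comment> \<open>The quotient by \<open>M\<close> is not formed: \<open>\<chi>\<close> takes
    values in \<open>K\<close>, and the relators are shown to land in \<open>M\<close>.\<close>
  obtain \<chi> where \<chi>: "\<chi> \<in> hom (free_Abelian_group ?S) (add_monoid (ring_on (UNIV :: 'k set)))"
    and \<chi>_of: "\<And>p. p \<in> ?S \<Longrightarrow> \<chi> (frag_of p) = fst p * g (decode (snd p))"
    using add.free_Abelian_group_universal[of "\<lambda>p. fst p * g (decode (snd p))" ?S] by auto
  interpret \<chi>: group_hom "free_Abelian_group ?S" "add_monoid (ring_on (UNIV :: 'k set))" \<chi>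
    using \<chi> by (intro group_hom.intro group_hom_axioms.intro add.group_axioms) simp
  have \<chi>_0: "\<chi> 0 = 0"
    using \<chi>.hom_one by simp
  have \<chi>_add: "\<chi> (v + w) = \<chi> v + \<chi> w"
    if "Poly_Mapping.keys v \<subseteq> ?S" "Poly_Mapping.keys w \<subseteq> ?S" for v w
    using \<chi>.hom_mult[of v w] that by simp
  have \<chi>_diff: "\<chi> (v - w) = \<chi> v - \<chi> w"
    if "Poly_Mapping.keys v \<subseteq> ?S" "Poly_Mapping.keys w \<subseteq> ?S" for v w
    using \<chi>_add[of "v - w" w] that by (simp add: keys_frag_diff_subset)
  have \<chi>_tensor: "\<chi> (frag_of (t, encode j)) = t * g j" if "t \<in> T" "j \<in> J" for t j
    using \<chi>_of[of "(t, encode j)"] that by simp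
  let ?H = "{w. Poly_Mapping.keys w \<subseteq> ?S \<and> \<chi> w \<in> M}"
  have "tensor_relators (ring_on E) (module_on T) ?N \<subseteq> ?H"
  proof
    fix w assume w: "w \<in> tensor_relators (ring_on E) (module_on T) ?N"
    then have "\<chi> w \<in> M"
      unfolding tensor_relators_def
    proof (elim UnE CollectE exE conjE)
      fix s t z assume w: "w = frag_of (s \<oplus>\<^bsub>module_on T\<^esub> t, z) - frag_of (s, z) - frag_of (t, z)"
        and st: "s \<in> carrier (module_on T)" "t \<in> carrier (module_on T)" "z \<in> carrier ?N"
      obtain j where "j \<in> J" "z = encode j"
        using st by auto
      then have "\<chi> w = (s + t) * g j - s * g j - t * g j"
        using st subrngD(4)[OF T', of s t] unfolding w
        by (simp add: \<chi>_diff \<chi>_tensor keys_frag_diff_subset)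
      then have "\<chi> w = 0"
        by (simp add: algebra_simps)
      then show ?thesis
        using M_0 by simp
    next
      fix t y z assume w: "w = frag_of (t, y \<oplus>\<^bsub>?N\<^esub> z) - frag_of (t, y) - frag_of (t, z)"
        and yz: "t \<in> carrier (module_on T)" "y \<in> carrier ?N" "z \<in> carrier ?N"
      obtain i j where ij: "i \<in> J" "y = encode i" "j \<in> J" "z = encode j"
        using yz by auto
      have "\<chi> w = t * g (i + j) - t * g i - t * g j"
        using ij yz J_add unfolding w by (simp add: \<chi>_diff \<chi>_tensor keys_frag_diff_subset)
      then have "\<chi> w = (g (i + j) - (g i + g j)) * t"
        by (simp add: algebra_simps)
      then show ?thesis
        using I_M[OF g_add] ij yz by simp
    next
      fix r t y assume w: "w = frag_of (r \<odot>\<^bsub>module_on T\<^esub> t, y) - frag_of (t, r \<odot>\<^bsub>?N\<^esub> y)"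
        and ry: "r \<in> carrier (ring_on E)" "t \<in> carrier (module_on T)" "y \<in> carrier ?N"
      obtain j where j: "j \<in> J" "y = encode j"
        using ry by auto
      have "r * t \<in> T"
        using ry ET subrngD(6)[OF T'] by auto
      then have "\<chi> w = r * t * g j - t * g (r * j)"
        using j ry J_mult unfolding w by (simp add: \<chi>_diff \<chi>_tensor)
      then have "\<chi> w = - ((g (r * j) - r * g j) * t)"
        by (simp add: algebra_simps)
      then show ?thesis
        using M_minus[OF I_M[OF g_mult]] j ry by simp
    qed
    moreover have "Poly_Mapping.keys w \<subseteq> ?S"
      using subsetD[OF tensor_relators_subset[OF Mod N] w] by simp
    ultimately show "w \<in> ?H"
      by simp
  qed
  moreover have "subgroup ?H (free_Abelian_group ?S)"
  proof (rule subgroup_free_Abelian_groupI)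
    show "v + w \<in> ?H" if "v \<in> ?H" "w \<in> ?H" for v w
      using that keys_add[of v w] \<chi>_add M_add by auto
    show "- w \<in> ?H" if "w \<in> ?H" for w
      using that \<chi>_diff[of 0 w] M_minus \<chi>_0 by auto
  qed (use \<chi>_0 M_0 in auto)
  ultimately have "tensor_kernel (ring_on E) (module_on T) ?N \<subseteq> ?H"
    by (intro tensor_kernel_subset) simp_all
  then have "\<chi> (frag_of (x, encode b) - frag_of (1, encode a)) \<in> M"
    using ker by blast
  then have xb: "x * g b - g a \<in> M"
    using x one ab_J by (simp add: \<chi>_diff \<chi>_tensor)
  have "g b - 0 \<in> I"
    using g(1)[of b 1 0] E' by simp
  then have gb: "g b * x \<in> M"
    using I_M x by simp
  have "g a - 1 \<in> I"
    using g(1)[of a 0 1] E' by simp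
  then have ga: "- ((g a - 1) * 1) \<in> M"
    using I_M one M_minus by blast
  \<comment> \<open>\<open>1 = g b * x - (x * g b - g a) - (g a - 1)\<close>, and all three terms
    lie in \<open>M\<close>.\<close>
  have "g b * x + (- (x * g b - g a) + (- ((g a - 1) * 1))) \<in> M"
    by (rule M_add[OF gb M_add[OF M_minus[OF xb] ga]])
  then have "1 \<in> M"
    by (simp add: algebra_simps)
  then show "1 \<in> mult_span (conductor E E x) T"
    by (simp add: M_def I_def)
qed

lemma flat_overring_iff:
  assumes "domain_with_quotient_field E"
  shows "flat_overring E T \<longleftrightarrow> T \<in> overrings E \<and> conductor_flat E T"
  using flat_module_imp_conductor_flat[OF assms] conductor_flat_imp_flat_module[OF dwqfD(1)[OF assms]]
  by (auto simp: flat_overring_def)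

section \<open>Complete and independent families\<close>

text \<open>Along a sum for \<open>x\<close>, denominators of the coefficient \<open>t\<close>
  multiply with denominators of the remaining sum. Membership in \<open>I T\<close> is thereby
  expressed through the ideal \<open>(I : x)\<close> of \<open>E\<close>.\<close>

lemma conductor_flat_mult_span:
  assumes E: "subrng E" and T: "T \<in> overrings E" "conductor_flat E T" and I: "ideal_on E I"
    and x: "x \<in> mult_span I T"
  shows "1 \<in> mult_span (conductor E I x) T"
  using x
proof induction
  case zero
  show ?case
    using subrngD(1)[OF E] ideal_onD(2)[OF I] overringsD(1)[OF T(1)]
    by (intro one_in_mult_span_self) (auto simp: conductor_def)
next
  case (step s t x)
  have "1 \<in> mult_span (conductor E E t) T"
    using T(2) step by (auto simp: conductor_flat_def)
  from this step.IH overringsD(1)[OF T(1)] show ?case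
  proof (rule one_in_mult_span_mult)
    fix d e assume d: "d \<in> conductor E E t" and e: "e \<in> conductor E I x"
    have "d * e * (s * t + x) = (d * t) * (e * s) + d * (e * x)"
      by (simp add: algebra_simps)
    then show "d * e \<in> conductor E I (s * t + x)"
      using d e step.hyps subrngD(6)[OF E] ideal_onD[OF I] by (simp add: conductor_def)
  qed
qed

text \<open>An \<open>x\<close> in every \<open>I T\<close> makes \<open>L = (I : x)\<close> extend
  to the unit ideal in each member, and \<open>1 \<in> L\<close> means \<open>x \<in> I\<close>.
  Conversely, an ideal that blows up everywhere has \<open>1\<close> in the intersection of its
  extensions.\<close>

lemma complete_family_iff:
  assumes E: "subrng E" and \<Theta>: "\<Theta> \<noteq> {}" "\<Theta> \<subseteq> overrings E" "\<And>T. T \<in> \<Theta> \<Longrightarrow> conductor_flat E T"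
  shows "complete_family E \<Theta> \<longleftrightarrow> (\<forall>L. ideal_on E L \<longrightarrow> (\<forall>T\<in>\<Theta>. 1 \<in> mult_span L T) \<longrightarrow> 1 \<in> L)"
proof -
  have ext: "Idl\<^bsub>ring_on T\<^esub> I = mult_span I T" if "T \<in> \<Theta>" "ideal_on E I" for T I
    using that \<Theta> overringsD[of T E] ideal_onD(1)[OF that(2)] by (intro genideal_ring_on) auto
  show ?thesis
  proof (intro iffI allI impI)
    fix L assume c: "complete_family E \<Theta>" and L: "ideal_on E L" "\<forall>T\<in>\<Theta>. 1 \<in> mult_span L T"
    then have "L = (\<Inter>T\<in>\<Theta>. mult_span L T)"
      using ext by (simp add: complete_family_def ideal_ring_on_iff[OF E])
    then show "1 \<in> L"
      using L by blast
  next
    assume *: "\<forall>L. ideal_on E L \<longrightarrow> (\<forall>T\<in>\<Theta>. 1 \<in> mult_span L T) \<longrightarrow> 1 \<in> L"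
    have "I = (\<Inter>T\<in>\<Theta>. mult_span I T)" if I: "ideal_on E I" for I
    proof
      show "I \<subseteq> (\<Inter>T\<in>\<Theta>. mult_span I T)"
      proof clarify
        fix x T assume "x \<in> I" "T \<in> \<Theta>"
        then show "x \<in> mult_span I T"
          using mult_span_mult[of x I 1 T] \<Theta>(2) subrngD(1) overringsD(1) by fastforce
      qed
      show "(\<Inter>T\<in>\<Theta>. mult_span I T) \<subseteq> I"
      proof
        fix x assume "x \<in> (\<Inter>T\<in>\<Theta>. mult_span I T)"
        then have "\<forall>T\<in>\<Theta>. 1 \<in> mult_span (conductor E I x) T"
          using conductor_flat_mult_span[OF E _ _ I] \<Theta> by blast
        then have "1 \<in> conductor E I x"
          using * ideal_on_conductor[OF E I] by blast
        then show "x \<in> I"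
          by (simp add: conductor_def)
      qed
    qed
    then show "complete_family E \<Theta>"
      using ext by (simp add: complete_family_def ideal_ring_on_iff[OF E])
  qed
qed

section \<open>Independence as generation of the field\<close>

text \<open>Zorn's lemma for the ideals that contain \<open>x\<close> but not \<open>1\<close>, a
  collection containing the principal ideal of the nonunit \<open>x\<close>; a maximal one is
  prime.\<close>

lemma exists_primeideal:
  assumes C: "subrng C" and x: "x \<in> C" "x \<noteq> 0" "inverse x \<notin> C"
  shows "\<exists>Q. primeideal Q (ring_on C) \<and> x \<in> Q"
proof -
  note C' = subrngD[OF C]
  define \<I> where "\<I> = {I. ideal_on C I \<and> x \<in> I \<and> 1 \<notin> I}"
  have "c * x \<noteq> 1" if "c \<in> C" for c
    using that x by (metis inverse_unique mult.commute)
  moreover have "x \<in> (\<lambda>c. c * x) ` C"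
    using C'(1) by (intro image_eqI[of _ _ 1]) auto
  moreover have "ideal_on C ((\<lambda>c. c * x) ` C)"
    unfolding ideal_on_def
  proof (intro conjI ballI)
    show "(\<lambda>c. c * x) ` C \<subseteq> C"
      using C'(6) x(1) by blast
    show "0 \<in> (\<lambda>c. c * x) ` C"
      using C'(2) by (intro image_eqI[of _ _ 0]) auto
  next
    fix u v assume "u \<in> (\<lambda>c. c * x) ` C" "v \<in> (\<lambda>c. c * x) ` C"
    then show "u + v \<in> (\<lambda>c. c * x) ` C"
      using C'(4) by (auto simp flip: distrib_right)
  next
    fix r u assume "r \<in> C" "u \<in> (\<lambda>c. c * x) ` C"
    then show "r * u \<in> (\<lambda>c. c * x) ` C"
      using C'(6) by (auto simp flip: mult.assoc)
  qed
  ultimately have "(\<lambda>c. c * x) ` C \<in> \<I>"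
    by (auto simp: \<I>_def)
  moreover have "\<Union>\<C> \<in> \<I>" if \<C>: "\<C> \<noteq> {}" "subset.chain \<I> \<C>" for \<C>
  proof -
    have sub: "\<And>I. I \<in> \<C> \<Longrightarrow> ideal_on C I \<and> x \<in> I \<and> 1 \<notin> I"
      and lin: "\<And>I J. I \<in> \<C> \<Longrightarrow> J \<in> \<C> \<Longrightarrow> I \<subseteq> J \<or> J \<subseteq> I"
      using \<C>(2) by (auto simp: subset.chain_def \<I>_def)
    have "u + v \<in> \<Union>\<C>" if uv: "u \<in> \<Union>\<C>" "v \<in> \<Union>\<C>" for u v
    proof -
      obtain I J where IJ: "I \<in> \<C>" "u \<in> I" "J \<in> \<C>" "v \<in> J"
        using uv by blast
      then obtain M where "M \<in> \<C>" "u \<in> M" "v \<in> M"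
        using lin[of I J] by blast
      then show ?thesis
        using ideal_onD(3) sub by blast
    qed
    moreover have "0 \<in> \<Union>\<C>" "x \<in> \<Union>\<C>"
      using sub \<C>(1) ideal_onD(2) by blast+
    moreover have "1 \<notin> \<Union>\<C>" "\<Union>\<C> \<subseteq> C"
      using sub ideal_onD(1) by blast+
    moreover have "\<forall>r\<in>C. \<forall>u\<in>\<Union>\<C>. r * u \<in> \<Union>\<C>"
      using sub ideal_onD(4) by blast
    ultimately show ?thesis
      by (auto simp: \<I>_def ideal_on_def)
  qed
  ultimately obtain Q where Q: "Q \<in> \<I>" and max: "\<And>I. I \<in> \<I> \<Longrightarrow> Q \<subseteq> I \<Longrightarrow> I = Q"
    using subset_Zorn_nonempty[of \<I>] by blast
  have Q': "ideal_on C Q" "x \<in> Q" "1 \<notin> Q"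
    using Q by (auto simp: \<I>_def)
  have "b \<in> Q" if ab: "a \<in> C" "b \<in> C" "a * b \<in> Q" "a \<notin> Q" for a b
  proof -
    \<comment> \<open>\<open>J = Q + C a\<close> is strictly larger than \<open>Q\<close>, hence
      contains \<open>1 = q + c * a\<close>; multiplying by \<open>b\<close> puts \<open>b\<close>
      into \<open>Q\<close>.\<close>
    define J where "J = {q + c * a | q c. q \<in> Q \<and> c \<in> C}"
    have QJ: "Q \<subseteq> J"
    proof
      fix q assume "q \<in> Q"
      then have "q = q + 0 * a" "0 \<in> C"
        using C' by auto
      then show "q \<in> J"
        unfolding J_def using \<open>q \<in> Q\<close> by blast
    qed
    have "a = 0 + 1 * a"
      by simp
    then have "a \<in> J"
      unfolding J_def using C'(1) ideal_onD(2)[OF Q'(1)] by blast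
    have "ideal_on C J"
      unfolding ideal_on_def
    proof (intro conjI ballI)
      show "J \<subseteq> C"
        using ideal_onD(1)[OF Q'(1)] C' ab by (auto simp: J_def)
      show "0 \<in> J"
        using QJ ideal_onD(2)[OF Q'(1)] by blast
    next
      fix u v assume "u \<in> J" "v \<in> J"
      then obtain q c q' c' where *: "q \<in> Q" "q' \<in> Q" "c \<in> C" "c' \<in> C" "u = q + c * a" "v = q' + c' * a"
        by (auto simp: J_def)
      then have "u + v = (q + q') + (c + c') * a"
        by (simp add: algebra_simps)
      then show "u + v \<in> J"
        unfolding J_def using * ideal_onD(3)[OF Q'(1)] C'(4) by blast
    next
      fix r u assume "r \<in> C" "u \<in> J"
      then obtain q c where *: "q \<in> Q" "c \<in> C" "u = q + c * a"
        by (auto simp: J_def)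
      then have "r * u = r * q + (r * c) * a"
        by (simp add: algebra_simps)
      then show "r * u \<in> J"
        unfolding J_def using * \<open>r \<in> C\<close> ideal_onD(4)[OF Q'(1)] C'(6) by blast
    qed
    moreover have "J \<noteq> Q"
      using \<open>a \<in> J\<close> ab(4) by blast
    ultimately have "1 \<in> J"
      using max[of J] QJ Q'(2) by (auto simp: \<I>_def)
    then obtain q c where qc: "q \<in> Q" "c \<in> C" "1 = q + c * a"
      by (auto simp: J_def)
    have "b = (q + c * a) * b"
      by (simp flip: qc(3))
    then have "b = b * q + c * (a * b)"
      by (simp add: algebra_simps)
    then show ?thesis
      using qc ab ideal_onD(3,4)[OF Q'(1)] by metis
  qed
  then have "primeideal Q (ring_on C)"
    using Q' by (auto simp: primeideal_ring_on_iff[OF C])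
  then show ?thesis
    using Q'(2) by blast
qed

lemma primeideal_contract:
  assumes "primeideal Q (ring_on C)" "subrng C" "subrng A" "A \<subseteq> C"
  shows "primeideal (Q \<inter> A) (ring_on A)"
  using assms(1,4) subrngD(1,2,4,6)[OF assms(3)]
  by (simp add: primeideal_ring_on_iff[OF assms(2)] primeideal_ring_on_iff[OF assms(3)] ideal_on_def
      subset_iff)

lemma contracted_spectrum_zero:
  assumes "subrng E" "T \<in> overrings E"
  shows "{0} \<in> contracted_spectrum E T"
proof -
  have "primeideal {0} (ring_on T)"
    using overringsD(1)[OF assms(2)] by (auto simp: primeideal_ring_on_iff ideal_on_def intro: subrngD)
  moreover have "{0} \<inter> E = {0}"
    using subrngD(2)[OF assms(1)] by auto
  ultimately show ?thesis
    unfolding contracted_spectrum_def by blast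
qed

lemma independent_imp_generates_field:
  assumes E: "domain_with_quotient_field E"
    and A: "A \<in> overrings E" "conductor_flat E A" and B: "B \<in> overrings E"
    and spec: "contracted_spectrum E A \<inter> contracted_spectrum E B = {{0}}"
  shows "generates_field E A B"
proof -
  note E' = subrngD[OF dwqfD(1)[OF E]] and A' = overringsD(1)[OF A(1)] and B' = overringsD(1)[OF B]
  note EA = overringsD(2)[OF A(1)] and EB = overringsD(2)[OF B]
  \<comment> \<open>\<open>C\<close> is the compositum \<open>A B\<close>: a nonzero prime of it would contract into both spectra.\<close>
  define C where "C = {x. 1 \<in> mult_span (conductor E B x) A}"
  have BC: "B \<subseteq> C"
    using E'(1) A' by (auto simp: C_def conductor_def intro: one_in_mult_span_self)
  \<comment> \<open>Flatness of \<open>A\<close> enters here: denominators that carry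
    \<open>x\<close> into \<open>E\<close> carry it into \<open>B\<close>.\<close>
  have AC: "A \<subseteq> C"
  proof
    fix x assume "x \<in> A"
    then have "1 \<in> mult_span (conductor E E x) A"
      using A(2) by (simp add: conductor_flat_def)
    then show "x \<in> C"
      unfolding C_def using EB by (auto simp: conductor_def elim: mult_span_mono)
  qed
  have C: "subrng C"
    unfolding subrng_def subring_ring_on_iff
  proof (intro conjI ballI)
    show "1 \<in> C"
      using subrngD(1)[OF B'] BC by blast
    fix x assume "x \<in> C"
    then show "- x \<in> C"
      unfolding C_def by (auto elim!: mult_span_mono simp: conductor_def dest: subrngD(3)[OF B'])
    fix y assume "y \<in> C"
    have xy: "1 \<in> mult_span (conductor E B x) A" "1 \<in> mult_span (conductor E B y) A"
      using \<open>x \<in> C\<close> \<open>y \<in> C\<close> by (auto simp: C_def)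
    have *: "d * e * (x + y) \<in> B" "d * e * (x * y) \<in> B"
      if "d \<in> conductor E B x" "e \<in> conductor E B y" for d e
    proof -
      have "d * e * (x + y) = e * (d * x) + d * (e * y)"
        by (simp add: algebra_simps)
      then show "d * e * (x + y) \<in> B"
        using that EB subrngD(4,6)[OF B'] by (simp add: conductor_def subset_iff)
      have "(d * x) * (e * y) \<in> B"
        using that subrngD(6)[OF B', of "d * x" "e * y"] by (simp add: conductor_def)
      then show "d * e * (x * y) \<in> B"
        by (simp add: mult_ac)
    qed
    have "d * e \<in> conductor E B (x + y)" "d * e \<in> conductor E B (x * y)"
      if "d \<in> conductor E B x" "e \<in> conductor E B y" for d e
      using *[OF that] that E'(6) by (auto simp: conductor_def)
    then show "x + y \<in> C" "x * y \<in> C"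
      unfolding C_def using one_in_mult_span_mult[OF xy A'] by auto
  qed
  have "C = UNIV"
  proof (rule ccontr)
    assume "C \<noteq> UNIV"
    then obtain y where "y \<notin> C"
      by blast
    obtain a b where ab: "a \<in> E" "b \<in> E" "b \<noteq> 0" "y = a / b"
      using dwqfD(2)[OF E, of y] by blast
    \<comment> \<open>Since \<open>y = a * inverse b\<close> is outside the ring \<open>C\<close>
      while \<open>a\<close> is inside, \<open>b\<close> is a nonzero nonunit of \<open>C\<close>
      that comes from \<open>E\<close>.\<close>
    have "inverse b \<notin> C"
      using ab \<open>y \<notin> C\<close> EA AC subrngD(6)[OF C, of a "inverse b"] by (auto simp: divide_inverse)
    moreover have "b \<in> C"
      using ab EA AC by blast
    ultimately obtain Q where Q: "primeideal Q (ring_on C)" "b \<in> Q"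
      using exists_primeideal[OF C _ ab(3)] by blast
    have "Q \<inter> A \<inter> E \<in> contracted_spectrum E A" "Q \<inter> B \<inter> E \<in> contracted_spectrum E B"
      using primeideal_contract[OF Q(1) C] A' B' AC BC by (auto simp: contracted_spectrum_def)
    moreover have "Q \<inter> A \<inter> E = Q \<inter> E" "Q \<inter> B \<inter> E = Q \<inter> E"
      using EA EB by auto
    ultimately have "Q \<inter> E = {0}"
      using spec by (metis IntI singletonD)
    then show False
      using Q(2) ab by blast
  qed
  then show ?thesis
    by (auto simp: generates_field_def C_def)
qed

text \<open>For \<open>p \<noteq> 0\<close> in a common prime \<open>P\<close>, a denominator
  \<open>d\<close> that carries \<open>1 / p\<close> into \<open>B\<close> satisfies
  \<open>d = (d / p) * p \<in> Q' \<inter> E = P \<subseteq> Q\<close>. These \<open>d\<close>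
  generate the unit ideal of \<open>A\<close>, contradicting \<open>1 \<notin> Q\<close>.\<close>

lemma generates_field_imp_independent:
  assumes E: "subrng E" and A: "A \<in> overrings E" and B: "B \<in> overrings E"
    and AB: "generates_field E A B"
  shows "contracted_spectrum E A \<inter> contracted_spectrum E B = {{0}}"
proof -
  note A' = overringsD(1)[OF A] and B' = overringsD(1)[OF B]
  have "P = {0}" if P: "P \<in> contracted_spectrum E A" "P \<in> contracted_spectrum E B" for P
  proof -
    obtain Q where Q: "primeideal Q (ring_on A)" "P = Q \<inter> E"
      using P(1) unfolding contracted_spectrum_def by blast
    obtain Q' where Q': "primeideal Q' (ring_on B)" "P = Q' \<inter> E"
      using P(2) unfolding contracted_spectrum_def by blast
    have Qi: "ideal_on A Q" "1 \<notin> Q" and Qi': "ideal_on B Q'"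
      using Q(1) Q'(1) by (auto simp: primeideal_ring_on_iff A' B')
    have "p = 0" if "p \<in> P" for p
    proof (rule ccontr)
      assume "p \<noteq> 0"
      have "1 * 1 \<in> Q"
      proof (rule mult_span_absorb)
        show "1 \<in> mult_span (conductor E B (1 / p)) A"
          using AB by (auto simp: generates_field_def)
        fix d assume "d \<in> conductor E B (1 / p)"
        then have d: "d \<in> E" "d / p \<in> B"
          by (auto simp: conductor_def)
        have "d / p * p \<in> Q'"
          using d(2) \<open>p \<in> P\<close> Q'(2) by (intro ideal_onD(4)[OF Qi']) auto
        then have "d \<in> P"
          using \<open>p \<noteq> 0\<close> d(1) Q'(2) by simp
        then show "d * 1 \<in> Q"
          using Q(2) by simp
      qed (use ideal_onD[OF Qi(1)] in auto)
      then show False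
        using Qi(2) by simp
    qed
    moreover have "0 \<in> P"
      using Q(2) ideal_onD(2)[OF Qi(1)] subrngD(2)[OF E] by blast
    ultimately show ?thesis
      by blast
  qed
  then show ?thesis
    using contracted_spectrum_zero[OF E A] contracted_spectrum_zero[OF E B] by blast
qed

section \<open>Compactness in the Zariski topology\<close>

lemma openin_zariski_basic: "finite F \<Longrightarrow> openin (zariski E) {T \<in> overrings E. F \<subseteq> T}"
  unfolding zariski_def openin_topology_generated_by_iff
  by (rule generate_topology_on.Basis) (simp add: exI[of _ F])

text \<open>The generating sets are closed under finite intersections, by taking unions of the
  finite sets \<open>F\<close>, so they form a basis.\<close>

lemma zariski_neighbourhood:
  assumes "openin (zariski E) U" "T \<in> U"
  shows "\<exists>F. finite F \<and> F \<subseteq> T \<and> (\<forall>S\<in>overrings E. F \<subseteq> S \<longrightarrow> S \<in> U)"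
proof -
  have "\<forall>T\<in>U. \<exists>F. finite F \<and> F \<subseteq> T \<and> (\<forall>S\<in>overrings E. F \<subseteq> S \<longrightarrow> S \<in> U)"
    if "generate_topology_on \<B> U" "\<B> = {{T \<in> overrings E. F \<subseteq> T} | F. finite F}" for \<B> U
    using that
  proof (induction rule: generate_topology_on.induct)
    case Empty
    show ?case by simp
  next
    case (Int a b)
    show ?case
    proof
      fix T assume T: "T \<in> a \<inter> b"
      obtain F where "finite F \<and> F \<subseteq> T \<and> (\<forall>S\<in>overrings E. F \<subseteq> S \<longrightarrow> S \<in> a)"
        using Int.IH(1)[OF Int.prems] T by auto
      moreover obtain G where "finite G \<and> G \<subseteq> T \<and> (\<forall>S\<in>overrings E. G \<subseteq> S \<longrightarrow> S \<in> b)"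
        using Int.IH(2)[OF Int.prems] T by auto
      ultimately show "\<exists>F. finite F \<and> F \<subseteq> T \<and> (\<forall>S\<in>overrings E. F \<subseteq> S \<longrightarrow> S \<in> a \<inter> b)"
        by (intro exI[of _ "F \<union> G"]) simp
    qed
  next
    case (UN K)
    show ?case
    proof
      fix T assume "T \<in> \<Union>K"
      then obtain a where a: "a \<in> K" "T \<in> a"
        by blast
      then obtain F where "finite F \<and> F \<subseteq> T \<and> (\<forall>S\<in>overrings E. F \<subseteq> S \<longrightarrow> S \<in> a)"
        using UN.IH[OF a(1) UN.prems] by auto
      then show "\<exists>F. finite F \<and> F \<subseteq> T \<and> (\<forall>S\<in>overrings E. F \<subseteq> S \<longrightarrow> S \<in> \<Union>K)"
        using a(1) by (intro exI[of _ F]) auto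
    qed
  next
    case (Basis s)
    then obtain F where "finite F" "s = {T \<in> overrings E. F \<subseteq> T}"
      by auto
    then show ?case
      by (intro ballI exI[of _ F]) simp
  qed
  then show ?thesis
    using assms by (simp add: zariski_def openin_topology_generated_by_iff)
qed

lemma compactin_zariski_iff:
  assumes "\<Theta> \<subseteq> overrings E"
  shows "compactin (zariski E) \<Theta> \<longleftrightarrow> finite_covers \<Theta>"
proof
  assume comp: "compactin (zariski E) \<Theta>"
  show "finite_covers \<Theta>"
    unfolding finite_covers_def
  proof (intro allI impI)
    fix F :: "'a set \<Rightarrow> 'a set"
    assume F: "\<forall>T\<in>\<Theta>. finite (F T) \<and> F T \<subseteq> T"
    define U where "U S = {T \<in> overrings E. F S \<subseteq> T}" for S
    have "openin (zariski E) V" if "V \<in> U ` \<Theta>" for V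
      using that F openin_zariski_basic by (auto simp: U_def)
    moreover have "\<Theta> \<subseteq> \<Union>(U ` \<Theta>)"
      using F assms by (auto simp: U_def)
    ultimately obtain \<F> where "finite \<F>" "\<F> \<subseteq> U ` \<Theta>" "\<Theta> \<subseteq> \<Union>\<F>"
      using comp unfolding compactin_def by meson
    then obtain \<Theta>\<^sub>0 where \<Theta>\<^sub>0: "\<Theta>\<^sub>0 \<subseteq> \<Theta>" "finite \<Theta>\<^sub>0" "\<Theta> \<subseteq> \<Union>(U ` \<Theta>\<^sub>0)"
      using finite_subset_image by metis
    have "\<exists>S\<in>\<Theta>\<^sub>0. F S \<subseteq> T" if T: "T \<in> \<Theta>" for T
    proof -
      obtain S where "S \<in> \<Theta>\<^sub>0" "T \<in> U S"
        using \<Theta>\<^sub>0(3) T by blast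
      then show ?thesis
        unfolding U_def by blast
    qed
    then show "\<exists>\<Theta>\<^sub>0\<subseteq>\<Theta>. finite \<Theta>\<^sub>0 \<and> (\<forall>T\<in>\<Theta>. \<exists>S\<in>\<Theta>\<^sub>0. F S \<subseteq> T)"
      using \<Theta>\<^sub>0 by meson
  qed
next
  assume fc: "finite_covers \<Theta>"
  show "compactin (zariski E) \<Theta>"
    unfolding compactin_def
  proof (intro conjI allI impI)
    show "\<Theta> \<subseteq> topspace (zariski E)"
      using assms openin_subset[OF openin_zariski_basic[of "{}" E]] by auto
    fix \<U> assume \<U>: "Ball \<U> (openin (zariski E)) \<and> \<Theta> \<subseteq> \<Union>\<U>"
    have "\<exists>F U. finite F \<and> F \<subseteq> T \<and> U \<in> \<U> \<and> (\<forall>S\<in>overrings E. F \<subseteq> S \<longrightarrow> S \<in> U)"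
      if T: "T \<in> \<Theta>" for T
    proof -
      obtain U where "U \<in> \<U>" "T \<in> U"
        using \<U> T by blast
      then show ?thesis
        using zariski_neighbourhood[of E U T] \<U> by meson
    qed
    then obtain F U where FU: "\<And>T. T \<in> \<Theta> \<Longrightarrow> finite (F T) \<and> F T \<subseteq> T \<and> U T \<in> \<U> \<and>
        (\<forall>S\<in>overrings E. F T \<subseteq> S \<longrightarrow> S \<in> U T)"
      by metis
    then obtain \<Theta>\<^sub>0 where \<Theta>\<^sub>0: "\<Theta>\<^sub>0 \<subseteq> \<Theta>" "finite \<Theta>\<^sub>0" "\<And>T. T \<in> \<Theta> \<Longrightarrow> \<exists>S\<in>\<Theta>\<^sub>0. F S \<subseteq> T"
      using fc unfolding finite_covers_def by metis
    have "T \<in> \<Union>(U ` \<Theta>\<^sub>0)" if "T \<in> \<Theta>" for T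
      using \<Theta>\<^sub>0(1) \<Theta>\<^sub>0(3)[OF that] FU assms that by (meson UN_I subsetD)
    then show "\<exists>\<F>. finite \<F> \<and> \<F> \<subseteq> \<U> \<and> \<Theta> \<subseteq> \<Union>\<F>"
      using FU \<Theta>\<^sub>0(1,2) by (intro exI[of _ "U ` \<Theta>\<^sub>0"]) auto
  qed
qed

section \<open>Intersections of compact subfamilies and Jaffard overrings\<close>

lemma flat_family_imp_generates_field:
  assumes "domain_with_quotient_field E" "\<And>T. T \<in> \<Theta> \<Longrightarrow> flat_overring E T" "independent_family E \<Theta>"
    and "A \<in> \<Theta>" "B \<in> \<Theta>" "A \<noteq> B"
  shows "generates_field E A B"
  using assms by (intro independent_imp_generates_field)
    (auto simp: flat_overring_iff independent_family_def)

text \<open>Each \<open>S\<close> needs only finitely many denominators \<open>G S\<close>, recorded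
  by the finite subset \<open>F S = G S x\<close> of \<open>S\<close>. Compactness leaves finitely
  many such sets, and products of their denominators carry \<open>x\<close> into all members at
  once.\<close>

lemma generates_field_Inter:
  assumes D: "subrng D" and \<Lambda>: "\<Lambda> \<subseteq> overrings D" "finite_covers \<Lambda>" and T: "T \<in> overrings D"
    and gen: "\<And>S. S \<in> \<Lambda> \<Longrightarrow> generates_field D T S"
  shows "generates_field D T (\<Inter>\<Lambda>)"
  unfolding generates_field_def
proof
  fix x
  note D' = subrngD[OF D] and T' = overringsD(1)[OF T]
  have "\<exists>G. finite G \<and> G \<subseteq> conductor D S x \<and> 1 \<in> mult_span G T" if S: "S \<in> \<Lambda>" for S
  proof -
    have "1 \<in> mult_span (conductor D S x) T"
      using gen[OF S] by (simp add: generates_field_def)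
    then obtain G H where "finite G" "G \<subseteq> conductor D S x" "H \<subseteq> T" "1 \<in> mult_span G H"
      using mult_span_finite by metis
    then show ?thesis
      using mult_span_mono[of 1 G H G T] by blast
  qed
  then obtain G where G: "\<And>S. S \<in> \<Lambda> \<Longrightarrow> finite (G S) \<and> G S \<subseteq> conductor D S x \<and> 1 \<in> mult_span (G S) T"
    by metis
  define F where "F S = (\<lambda>g. g * x) ` G S" for S
  have F: "finite (F S) \<and> F S \<subseteq> S" if "S \<in> \<Lambda>" for S
    using G[OF that] by (auto simp: F_def conductor_def)
  then obtain \<Lambda>\<^sub>0 where \<Lambda>\<^sub>0: "\<Lambda>\<^sub>0 \<subseteq> \<Lambda>" "finite \<Lambda>\<^sub>0" "\<And>S. S \<in> \<Lambda> \<Longrightarrow> \<exists>S'\<in>\<Lambda>\<^sub>0. F S' \<subseteq> S"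
    using \<Lambda>(2) unfolding finite_covers_def by metis
  \<comment> \<open>\<open>d * x\<close> is kept in the \<open>D\<close>-span of \<open>F S\<close>
    and not merely in \<open>S\<close>, because that span lies in every member containing
    \<open>F S\<close>.\<close>
  have "1 \<in> mult_span {d \<in> D. \<forall>S\<in>\<Lambda>\<^sub>0. d * x \<in> mult_span (F S) D} T"
    using \<Lambda>\<^sub>0(2,1)
  proof (induction rule: finite_induct)
    case empty
    show ?case
      using D'(1) T' by (intro one_in_mult_span_self) auto
  next
    case (insert S \<Lambda>')
    have "1 \<in> mult_span (G S) T" "1 \<in> mult_span {d \<in> D. \<forall>S\<in>\<Lambda>'. d * x \<in> mult_span (F S) D} T"
      using insert G by auto
    from this T' show ?case
    proof (rule one_in_mult_span_mult)
      fix g d assume g: "g \<in> G S" and d: "d \<in> {d \<in> D. \<forall>S\<in>\<Lambda>'. d * x \<in> mult_span (F S) D}"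
      have gD: "g \<in> D"
        using g G insert.prems by (auto simp: conductor_def)
      have "(g * x) * d \<in> mult_span (F S) D"
        using g d by (intro mult_span_mult) (auto simp: F_def)
      moreover have "(g * x) * d = g * d * x"
        by (simp add: algebra_simps)
      moreover have "g * d * x \<in> mult_span (F S') D" if "S' \<in> \<Lambda>'" for S'
        using mult_span_scale[of "d * x" "F S'" D g] that d gD D'(6) by (simp add: mult.assoc)
      ultimately show "g * d \<in> {d \<in> D. \<forall>S\<in>insert S \<Lambda>'. d * x \<in> mult_span (F S) D}"
        using gD d D'(6) by auto
    qed
  qed
  moreover have "d \<in> conductor D (\<Inter>\<Lambda>) x" if d: "d \<in> D" "\<forall>S\<in>\<Lambda>\<^sub>0. d * x \<in> mult_span (F S) D" for d
  proof -
    have "d * x \<in> S" if S: "S \<in> \<Lambda>" for S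
    proof -
      obtain S' where "S' \<in> \<Lambda>\<^sub>0" "F S' \<subseteq> S"
        using \<Lambda>\<^sub>0(3)[OF S] by blast
      then have "d * x \<in> mult_span S S"
        using d(2) mult_span_mono \<Lambda>(1) S overringsD(2) by blast
      then show ?thesis
        using mult_span_subset[of S S] overringsD(1) \<Lambda>(1) S by blast
    qed
    then show ?thesis
      using d(1) by (simp add: conductor_def)
  qed
  ultimately show "1 \<in> mult_span (conductor D (\<Inter>\<Lambda>) x) T"
    by (auto elim: mult_span_mono)
qed

text \<open>Every \<open>l \<in> L\<close> lies in \<open>T\<close>, so elements \<open>d\<close> of
  \<open>D\<close> with \<open>d * l \<in> L \<inter> D\<close> generate the unit ideal of
  \<open>T\<close>. Hence \<open>l\<close> lies in the extension of \<open>L \<inter> D\<close>, and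
  with all these \<open>l\<close> so does \<open>1\<close>.\<close>

lemma mult_span_contract:
  assumes D: "subrng D" and T: "T \<in> overrings D" "conductor_flat D T"
    and C: "C \<in> overrings D" "C \<subseteq> T" and L: "ideal_on C L" "1 \<in> mult_span L T"
  shows "1 \<in> mult_span (L \<inter> D) T"
proof -
  note T' = overringsD(1)[OF T(1)]
  have M: "t * u \<in> mult_span (L \<inter> D) T" if "t \<in> T" "u \<in> mult_span (L \<inter> D) T" for t u
    using that T' by (auto intro: mult_span_scale subrngD)
  have "l \<in> mult_span (L \<inter> D) T" if l: "l \<in> L" for l
  proof -
    have "l \<in> T"
      using l ideal_onD(1)[OF L(1)] C(2) by blast
    then have "1 \<in> mult_span (conductor D D l) T"
      using T(2) by (simp add: conductor_flat_def)
    then have "1 * l \<in> mult_span (L \<inter> D) T"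
    proof (rule mult_span_absorb)
      fix d assume "d \<in> conductor D D l"
      then have "d * l \<in> L \<inter> D"
        using ideal_onD(4)[OF L(1)] l overringsD(2)[OF C(1)] by (auto simp: conductor_def)
      then show "d * l \<in> mult_span (L \<inter> D) T"
        using mult_span_mult[of "d * l" _ 1] subrngD(1)[OF T'] by fastforce
    qed (auto intro: M mult_span.zero mult_span_add)
    then show ?thesis by simp
  qed
  then have "1 * 1 \<in> mult_span (L \<inter> D) T"
    by (intro mult_span_absorb[OF L(2)]) (auto intro: M mult_span.zero mult_span_add)
  then show ?thesis by simp
qed

lemma pre_jaffardD:
  assumes "domain_with_quotient_field D" "pre_jaffard_family D \<Theta>"
  shows "\<Theta> \<noteq> {}" "\<Theta> \<subseteq> overrings D" "\<And>T. T \<in> \<Theta> \<Longrightarrow> conductor_flat D T" "finite_covers \<Theta>"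
    "\<And>L. ideal_on D L \<Longrightarrow> (\<And>T. T \<in> \<Theta> \<Longrightarrow> 1 \<in> mult_span L T) \<Longrightarrow> 1 \<in> L"
    "\<And>A B. A \<in> \<Theta> \<Longrightarrow> B \<in> \<Theta> \<Longrightarrow> A \<noteq> B \<Longrightarrow> generates_field D A B"
    "UNIV \<in> \<Theta> \<Longrightarrow> \<Theta> = {UNIV}" "\<And>T. T \<in> \<Theta> \<Longrightarrow> domain_with_quotient_field T"
proof -
  have *: "\<Theta> \<subseteq> overrings D" "\<And>T. T \<in> \<Theta> \<Longrightarrow> flat_overring D T" "complete_family D \<Theta>"
    "independent_family D \<Theta>" "compactin (zariski D) \<Theta>" "UNIV \<notin> \<Theta> \<or> \<Theta> = {UNIV}"
    using assms(2) by (simp_all add: pre_jaffard_family_def)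
  show ne: "\<Theta> \<noteq> {}"
    using *(3) not_complete_empty dwqfD(1)[OF assms(1)] by (auto simp: subrng_def)
  show fl: "conductor_flat D T" if "T \<in> \<Theta>" for T
    using *(2)[OF that] assms(1) by (simp add: flat_overring_iff)
  show "\<Theta> \<subseteq> overrings D" "UNIV \<in> \<Theta> \<Longrightarrow> \<Theta> = {UNIV}"
    using * by auto
  show "finite_covers \<Theta>"
    using * by (simp add: compactin_zariski_iff)
  show "1 \<in> L" if "ideal_on D L" "\<And>T. T \<in> \<Theta> \<Longrightarrow> 1 \<in> mult_span L T" for L
    using *(3) that complete_family_iff[OF dwqfD(1)[OF assms(1)] ne *(1) fl] by blast
  show "generates_field D A B" if "A \<in> \<Theta>" "B \<in> \<Theta>" "A \<noteq> B" for A B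
    using flat_family_imp_generates_field[OF assms(1) *(2) *(4)] that by blast
  show "domain_with_quotient_field T" if "T \<in> \<Theta>" for T
    using *(1) assms(1) domain_with_quotient_field_overring that by blast
qed

text \<open>Completeness over the intersection is inherited from \<open>\<Theta>\<close> by
  contracting an ideal \<open>L\<close> to \<open>L \<inter> D\<close>. Flatness of the intersection
  over \<open>D\<close> is then an application of this completeness.\<close>

lemma Inter_compact_subfamily:
  assumes D: "domain_with_quotient_field D" and \<Theta>: "pre_jaffard_family D \<Theta>"
    and \<Lambda>: "\<Lambda> \<subseteq> \<Theta>" "\<Lambda> \<noteq> {}" "finite_covers \<Lambda>"
  shows "\<Inter>\<Lambda> \<in> overrings D" "conductor_flat D (\<Inter>\<Lambda>)" "pre_jaffard_family (\<Inter>\<Lambda>) \<Lambda>"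
    "T \<in> \<Theta> - \<Lambda> \<Longrightarrow> generates_field D T (\<Inter>\<Lambda>)"
proof -
  note D' = dwqfD(1)[OF D] and P = pre_jaffardD[OF D \<Theta>]
  define C where "C = \<Inter>\<Lambda>"
  have over: "\<Lambda> \<subseteq> overrings D"
    using \<Lambda>(1) P(2) by blast
  then have "subrng C" "D \<subseteq> C"
    unfolding C_def using overringsD by (blast intro: subrng_Inter)+
  then have C: "C \<in> overrings D"
    by (rule overringsI)
  show gen: "generates_field D T (\<Inter>\<Lambda>)" if "T \<in> \<Theta> - \<Lambda>" for T
    using that \<Lambda>(1) P(2,6) by (intro generates_field_Inter[OF D' over \<Lambda>(3)]) auto
  have compl: "1 \<in> L" if L: "ideal_on C L" "\<And>T. T \<in> \<Lambda> \<Longrightarrow> 1 \<in> mult_span L T" for L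
  proof -
    have gen_L: "1 \<in> mult_span (L \<inter> D) T" if "T \<in> \<Lambda>" for T
      using that \<Lambda>(1) P(2,3) C L by (intro mult_span_contract[OF D' _ _ C _ L(1)]) (auto simp: C_def)
    have ideal: "ideal_on D (L \<inter> D)"
      using ideal_onD[OF L(1)] subrngD[OF D'] \<open>D \<subseteq> C\<close> by (auto simp: ideal_on_def)
    have "x = 0" if "x \<in> mult_span (L \<inter> D) T" "L \<inter> D \<subseteq> {0}" for x T
      using that by induction auto
    \<comment> \<open>The zero ideal extends to zero, so \<open>L \<inter> D\<close> has a nonzero
      element \<open>l\<close>. For \<open>T\<close> outside \<open>\<Lambda>\<close>, denominators
      that carry \<open>1 / l\<close> into \<open>C\<close> are multiples of \<open>l\<close> in
      \<open>C\<close> and so lie in \<open>L\<close>.\<close>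
    then obtain l where l: "l \<in> L \<inter> D" "l \<noteq> 0"
      using gen_L \<Lambda>(2) by (metis all_not_in_conv singleton_iff subsetI zero_neq_one)
    have "1 \<in> mult_span (L \<inter> D) T" if "T \<in> \<Theta> - \<Lambda>" for T
    proof -
      have "1 \<in> mult_span (conductor D C (1 / l)) T"
        using gen[OF that] by (simp add: generates_field_def C_def)
      moreover have "conductor D C (1 / l) \<subseteq> L \<inter> D"
      proof
        fix d assume "d \<in> conductor D C (1 / l)"
        then have d: "d \<in> D" "d / l \<in> C"
          by (auto simp: conductor_def)
        then have "d / l * l \<in> L"
          using l ideal_onD(4)[OF L(1)] by blast
        then show "d \<in> L \<inter> D"
          using d l(2) by simp
      qed
      ultimately show ?thesis
        by (rule mult_span_mono) simp
    qed
    then show ?thesis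
      using P(5)[OF ideal] gen_L by blast
  qed
  have CD: "domain_with_quotient_field C"
    using D C by (rule domain_with_quotient_field_overring)
  show "\<Inter>\<Lambda> \<in> overrings D"
    using C by (simp add: C_def)
  \<comment> \<open>Completeness is applied to the ideal \<open>(D : c) C\<close>: every
    \<open>T \<in> \<Lambda>\<close> contains \<open>c\<close> and is flat over \<open>D\<close>, so
    this ideal blows up in \<open>T\<close>.\<close>
  have "1 \<in> mult_span (conductor D D c) C" if "c \<in> C" for c
  proof (rule compl)
    have sub: "conductor D D c \<subseteq> C"
      using \<open>D \<subseteq> C\<close> by (auto simp: conductor_def)
    then show "ideal_on C (mult_span (conductor D D c) C)"
      using \<open>subrng C\<close> by (rule ideal_on_mult_span[rotated])
    fix T assume T: "T \<in> \<Lambda>"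
    have "c \<in> T"
      using that T by (simp add: C_def)
    then have "1 \<in> mult_span (conductor D D c) T"
      using P(3) \<Lambda>(1) T by (auto simp: conductor_flat_def)
    moreover have "conductor D D c \<subseteq> mult_span (conductor D D c) C"
      using mult_span_mult[of _ "conductor D D c" 1 C] subrngD(1)[OF \<open>subrng C\<close>] by fastforce
    ultimately show "1 \<in> mult_span (mult_span (conductor D D c) C) T"
      by (rule mult_span_mono) simp
  qed
  then show "conductor_flat D (\<Inter>\<Lambda>)"
    by (simp add: conductor_flat_def C_def)
  have overC: "\<Lambda> \<subseteq> overrings C"
    using over overringsD(1) by (auto intro: overringsI simp: C_def)
  have flC: "conductor_flat C T" if "T \<in> \<Lambda>" for T
    unfolding conductor_flat_def
  proof
    fix x assume "x \<in> T"
    then have "1 \<in> mult_span (conductor D D x) T"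
      using P(3) \<Lambda>(1) that by (auto simp: conductor_flat_def)
    then show "1 \<in> mult_span (conductor C C x) T"
      by (rule mult_span_mono) (use \<open>D \<subseteq> C\<close> in \<open>auto simp: conductor_def\<close>)
  qed
  have "generates_field C A B" if "A \<in> \<Lambda>" "B \<in> \<Lambda>" "A \<noteq> B" for A B
    unfolding generates_field_def
  proof
    fix x
    have "1 \<in> mult_span (conductor D B x) A"
      using P(6) \<Lambda>(1) that by (auto simp: generates_field_def)
    then show "1 \<in> mult_span (conductor C B x) A"
      by (rule mult_span_mono) (use \<open>D \<subseteq> C\<close> in \<open>auto simp: conductor_def\<close>)
  qed
  then have "independent_family C \<Lambda>"
    using generates_field_imp_independent[OF \<open>subrng C\<close>] overC unfolding independent_family_def by blast
  moreover have "complete_family C \<Lambda>"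
    using complete_family_iff[OF \<open>subrng C\<close> \<Lambda>(2) overC flC] compl by blast
  moreover have "UNIV \<notin> \<Lambda> \<or> \<Lambda> = {UNIV}"
    using \<Lambda> P(7) by auto
  ultimately show "pre_jaffard_family (\<Inter>\<Lambda>) \<Lambda>"
    unfolding C_def[symmetric] pre_jaffard_family_def
    using overC flC \<Lambda>(3) CD by (auto simp: flat_overring_iff compactin_zariski_iff)
qed

section \<open>Separating a Jaffard overring from the other members\<close>

text \<open>In a Jaffard family \<open>\<Phi>\<close> containing \<open>T\<close> only finitely many
  members omit \<open>x\<close>, so their denominators can be multiplied. The result passes to
  \<open>\<Theta>\<close> because the other members of \<open>\<Phi>\<close> have the smaller
  intersection.\<close>

lemma jaffard_overring_generates_field:
  assumes E: "domain_with_quotient_field E" and \<Theta>: "pre_jaffard_family E \<Theta>"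
    and T: "T \<in> \<Theta>" "jaffard_overring E T"
  shows "generates_field E T (\<Inter>(\<Theta> - {T}))"
  unfolding generates_field_def
proof
  fix x
  note E' = dwqfD(1)[OF E] and P = pre_jaffardD[OF E \<Theta>]
  obtain \<Phi> where "jaffard_family E \<Phi>" and T\<Phi>: "T \<in> \<Phi>"
    using T(2) by (auto simp: jaffard_overring_def)
  then have \<Phi>: "\<Phi> \<subseteq> overrings E" "\<And>S. S \<in> \<Phi> \<Longrightarrow> flat_overring E S" "complete_family E \<Phi>"
    "independent_family E \<Phi>" "locally_finite_family \<Phi>"
    by (simp_all add: jaffard_family_def)
  have fl: "\<And>S. S \<in> \<Phi> \<Longrightarrow> conductor_flat E S"
    using \<Phi>(2) E by (simp add: flat_overring_iff)
  have T': "subrng T"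
    using P(2) T(1) overringsD(1) by blast
  \<comment> \<open>For \<open>A \<in> \<Theta> - {T}\<close> the ideal \<open>(A : y)\<close> blows
    up in \<open>T\<close> by independence of \<open>\<Theta>\<close>, and in the other members of
    \<open>\<Phi>\<close> because they are flat and contain \<open>y\<close>. Completeness of
    \<open>\<Phi>\<close> gives \<open>y \<in> A\<close>.\<close>
  have sub: "\<Inter>(\<Phi> - {T}) \<subseteq> \<Inter>(\<Theta> - {T})"
  proof (intro subsetI InterI)
    fix y A assume y: "y \<in> \<Inter>(\<Phi> - {T})" and "A \<in> \<Theta> - {T}"
    then have A: "A \<in> \<Theta>" "A \<noteq> T"
      by auto
    have "1 \<in> mult_span (conductor E A y) S" if S: "S \<in> \<Phi>" for S
    proof (cases "S = T")
      case True
      then show ?thesis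
        using P(6)[OF T(1) A(1)] A(2) by (auto simp: generates_field_def)
    next
      case False
      then have "1 \<in> mult_span (conductor E E y) S"
        using fl[OF S] S y by (auto simp: conductor_flat_def)
      then show ?thesis
        by (rule mult_span_mono) (use P(2) A overringsD(2) in \<open>auto simp: conductor_def\<close>)
    qed
    moreover have "ideal_on E (conductor E A y)"
      using P(2) A(1) by (intro ideal_on_conductor_overring[OF E']) auto
    ultimately have "1 \<in> conductor E A y"
      using \<Phi>(3) complete_family_iff[OF E' _ \<Phi>(1) fl] T\<Phi> by blast
    then show "y \<in> A"
      by (simp add: conductor_def)
  qed
  have "1 \<in> mult_span (conductor E (\<Inter>(\<Phi> - {T})) x) T"
  proof (cases "x = 0")
    case True
    then show ?thesis
      using subrngD(1)[OF E'] T' \<Phi>(1) overringsD(1) subrngD(2)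
      by (intro one_in_mult_span_self) (auto simp: conductor_def)
  next
    case False
    \<comment> \<open>A nonzero \<open>x\<close> outside \<open>S\<close> is a nonunit of
      \<open>S\<close>, so local finiteness bounds \<open>\<Psi>\<close>.\<close>
    define \<Psi> where "\<Psi> = {S \<in> \<Phi> - {T}. x \<notin> S}"
    have "finite \<Psi>"
      using \<Phi>(5) False unfolding locally_finite_family_def \<Psi>_def
      by (rule_tac finite_subset[of _ "{S \<in> \<Phi>. x \<notin> Units (ring_on S)}"]) (auto simp: Units_def)
    moreover have "\<Psi> \<subseteq> \<Phi> - {T}"
      by (auto simp: \<Psi>_def)
    ultimately have "1 \<in> mult_span {d \<in> E. \<forall>S\<in>\<Psi>. d * x \<in> S} T"
    proof (induction rule: finite_induct)
      case empty
      show ?case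
        using subrngD(1)[OF E'] T' by (intro one_in_mult_span_self) auto
    next
      case (insert S \<Psi>')
      have "1 \<in> mult_span (conductor E S x) T"
        using flat_family_imp_generates_field[OF E \<Phi>(2,4) T\<Phi>, of S] insert.prems
        by (auto simp: generates_field_def)
      moreover have "1 \<in> mult_span {d \<in> E. \<forall>S\<in>\<Psi>'. d * x \<in> S} T"
        using insert by auto
      ultimately show ?case
        using T'
      proof (rule one_in_mult_span_mult)
        fix d e assume d: "d \<in> conductor E S x" and e: "e \<in> {d \<in> E. \<forall>S\<in>\<Psi>'. d * x \<in> S}"
        have S: "S \<in> overrings E"
          using insert.prems \<Phi>(1) by blast
        have "e * (d * x) \<in> S"
          using d e overringsD[OF S] subrngD(6)[of S e "d * x"] by (auto simp: conductor_def)
        then have "d * e * x \<in> S"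
          by (simp add: mult_ac)
        moreover have "d * e * x \<in> S'" if "S' \<in> \<Psi>'" for S'
        proof -
          have "S' \<in> overrings E"
            using that insert.prems \<Phi>(1) by blast
          then show ?thesis
            using d e that overringsD[of S' E] subrngD(6)[of S' d "e * x"]
            by (auto simp: conductor_def mult.assoc)
        qed
        ultimately show "d * e \<in> {d \<in> E. \<forall>S\<in>insert S \<Psi>'. d * x \<in> S}"
          using d e subrngD(6)[OF E'] by (auto simp: conductor_def)
      qed
    qed
    moreover have "d * x \<in> S" if "d \<in> E" "\<forall>S\<in>\<Psi>. d * x \<in> S" "S \<in> \<Phi>" "S \<noteq> T" for d S
    proof (cases "x \<in> S")
      case True
      then show ?thesis
        using that \<Phi>(1) overringsD[of S E] subrngD(6)[of S] by blast
    next
      case False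
      then show ?thesis
        using that by (simp add: \<Psi>_def)
    qed
    ultimately show ?thesis
      by (elim mult_span_mono) (auto simp: conductor_def)
  qed
  then show "1 \<in> mult_span (conductor E (\<Inter>(\<Theta> - {T})) x) T"
    by (rule mult_span_mono) (use sub in \<open>auto simp: conductor_def\<close>)
qed

text \<open>Write \<open>1\<close> as a sum of products \<open>g * h\<close> with
  \<open>g * x\<close> in every other member. A member containing the finitely many \<open>h\<close>
  then contains \<open>x\<close>, so these \<open>h\<close> serve as \<open>U\<close>.\<close>

lemma generates_field_neighbourhood:
  assumes "generates_field E T (\<Inter>(\<Theta> - {T}))" "finite F" "\<Theta> \<subseteq> overrings E"
  shows "\<exists>U. finite U \<and> U \<subseteq> T \<and> (\<forall>A\<in>\<Theta> - {T}. U \<subseteq> A \<longrightarrow> F \<subseteq> A)"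
proof -
  have "\<exists>U. finite U \<and> U \<subseteq> T \<and> (\<forall>A\<in>\<Theta> - {T}. U \<subseteq> A \<longrightarrow> x \<in> A)" for x
  proof -
    have "1 \<in> mult_span (conductor E (\<Inter>(\<Theta> - {T})) x) T"
      using assms(1) by (simp add: generates_field_def)
    then obtain G H where GH: "G \<subseteq> conductor E (\<Inter>(\<Theta> - {T})) x" "finite H" "H \<subseteq> T"
      "1 \<in> mult_span G H"
      using mult_span_finite by metis
    have "x \<in> A" if A: "A \<in> \<Theta> - {T}" "H \<subseteq> A" for A
    proof -
      have A': "subrng A"
        using A assms(3) overringsD(1) by blast
      have "1 * x \<in> A"
        using GH(1) A subrngD[OF A'] by (intro mult_span_absorb[OF GH(4)]) (auto simp: conductor_def)
      then show ?thesis by simp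
    qed
    then show ?thesis
      using GH(2,3) by blast
  qed
  then obtain U where U: "\<And>x. finite (U x) \<and> U x \<subseteq> T \<and> (\<forall>A\<in>\<Theta> - {T}. U x \<subseteq> A \<longrightarrow> x \<in> A)"
    by metis
  then show ?thesis
    using assms(2) by (intro exI[of _ "\<Union>(U ` F)"]) blast
qed

section \<open>Compactness of what remains\<close>

text \<open>Each member outside \<open>\<Lambda>\<close> gets a neighbourhood that, within
  \<open>\<Lambda>\<close>, stays inside the basic open set of one fixed \<open>S\<^sub>0\<close>.
  In a finite subcover of \<open>\<Theta>\<close> all these members are replaced by
  \<open>S\<^sub>0\<close>.\<close>

lemma finite_covers_remainder:
  assumes \<Theta>: "finite_covers \<Theta>" and \<Lambda>: "\<Lambda> \<subseteq> \<Theta>"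
    and sep: "\<And>T F. T \<in> \<Theta> - \<Lambda> \<Longrightarrow> finite F \<Longrightarrow>
      \<exists>U. finite U \<and> U \<subseteq> T \<and> (\<forall>A\<in>\<Lambda>. U \<subseteq> A \<longrightarrow> F \<subseteq> A)"
  shows "finite_covers \<Lambda>"
proof (cases "\<Lambda> = {}")
  case True
  then show ?thesis
    by (simp add: finite_covers_def)
next
  case False
  then obtain S\<^sub>0 where S\<^sub>0: "S\<^sub>0 \<in> \<Lambda>"
    by blast
  show ?thesis
    unfolding finite_covers_def
  proof (intro allI impI)
    fix F :: "'a set \<Rightarrow> 'a set"
    assume F: "\<forall>T\<in>\<Lambda>. finite (F T) \<and> F T \<subseteq> T"
    have "\<forall>T\<in>\<Theta> - \<Lambda>. \<exists>U. finite U \<and> U \<subseteq> T \<and> (\<forall>A\<in>\<Lambda>. U \<subseteq> A \<longrightarrow> F S\<^sub>0 \<subseteq> A)"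
      using sep F S\<^sub>0 by blast
    then obtain U where U: "\<And>T. T \<in> \<Theta> - \<Lambda> \<Longrightarrow>
        finite (U T) \<and> U T \<subseteq> T \<and> (\<forall>A\<in>\<Lambda>. U T \<subseteq> A \<longrightarrow> F S\<^sub>0 \<subseteq> A)"
      by metis
    define G where "G T = (if T \<in> \<Lambda> then F T else U T)" for T
    have "\<forall>T\<in>\<Theta>. finite (G T) \<and> G T \<subseteq> T"
      using F U by (simp add: G_def)
    then obtain \<Theta>\<^sub>0 where \<Theta>\<^sub>0: "\<Theta>\<^sub>0 \<subseteq> \<Theta>" "finite \<Theta>\<^sub>0" "\<And>T. T \<in> \<Theta> \<Longrightarrow> \<exists>S\<in>\<Theta>\<^sub>0. G S \<subseteq> T"
      using \<Theta> unfolding finite_covers_def by metis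
    have "\<exists>S\<in>insert S\<^sub>0 (\<Theta>\<^sub>0 \<inter> \<Lambda>). F S \<subseteq> T" if T: "T \<in> \<Lambda>" for T
    proof -
      obtain S where S: "S \<in> \<Theta>\<^sub>0" "G S \<subseteq> T"
        using \<Theta>\<^sub>0(3) T \<Lambda> by blast
      show ?thesis
      proof (cases "S \<in> \<Lambda>")
        case True
        then show ?thesis
          using S by (auto simp: G_def)
      next
        case False
        then show ?thesis
          using S U[of S] \<Theta>\<^sub>0(1) T by (auto simp: G_def)
      qed
    qed
    then show "\<exists>\<Lambda>\<^sub>0\<subseteq>\<Lambda>. finite \<Lambda>\<^sub>0 \<and> (\<forall>T\<in>\<Lambda>. \<exists>S\<in>\<Lambda>\<^sub>0. F S \<subseteq> T)"
      using \<Theta>\<^sub>0(2) S\<^sub>0 by (intro exI[of _ "insert S\<^sub>0 (\<Theta>\<^sub>0 \<inter> \<Lambda>)"]) auto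
  qed
qed

section \<open>The derived sequence\<close>

lemma derived_family_cases [case_names zero successor limit]:
  obtains "is_zero \<alpha>" | \<gamma> where "is_successor \<gamma> \<alpha>" | "is_limit \<alpha>"
  by (auto simp: is_limit_def)

lemma derived_family_antimono:
  "\<beta> \<le> \<alpha> \<Longrightarrow> derived_family D \<Theta> \<alpha> \<subseteq> derived_family D \<Theta> \<beta>"
proof (induction \<alpha> rule: less_induct)
  case (less \<alpha>)
  show ?case
  proof (cases "\<beta> = \<alpha>")
    case False
    then have "\<beta> < \<alpha>"
      using less.prems by simp
    show ?thesis
    proof (cases \<alpha> rule: derived_family_cases)
      case zero
      then show ?thesis
        using \<open>\<beta> < \<alpha>\<close> by (meson is_zero_def leD)
    next
      case (successor \<gamma>)
      then have "\<gamma> < \<alpha>" "\<beta> \<le> \<gamma>"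
        using \<open>\<beta> < \<alpha>\<close> by (auto simp: is_successor_def)
      then show ?thesis
        using less.IH[of \<gamma>] derived_family_successor[OF successor] by blast
    next
      case limit
      then show ?thesis
        using \<open>\<beta> < \<alpha>\<close> derived_family_limit by blast
    qed
  qed simp
qed

lemma derived_family_subset: "derived_family D \<Theta> \<alpha> \<subseteq> \<Theta>"
proof (induction \<alpha> rule: less_induct)
  case (less \<alpha>)
  show ?case
  proof (cases \<alpha> rule: derived_family_cases)
    case zero
    then show ?thesis
      by (simp add: derived_family_zero)
  next
    case (successor \<gamma>)
    then show ?thesis
      using less[of \<gamma>] derived_family_successor[OF successor] by (auto simp: is_successor_def)
  next
    case limit
    then obtain \<beta> where "\<beta> < \<alpha>"
      by (auto simp: is_limit_def is_zero_def not_le)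
    then show ?thesis
      using less[of \<beta>] derived_family_antimono[OF less_imp_le] by blast
  qed
qed

text \<open>Limit stages only intersect, so a member is lost at a successor step, where it is a
  Jaffard overring of the preceding ring.\<close>

lemma leaves_derived_family:
  assumes "T \<in> \<Theta>" "T \<notin> derived_family D \<Theta> \<alpha>"
  shows "\<exists>\<beta><\<alpha>. T \<in> derived_family D \<Theta> \<beta> \<and> jaffard_overring (derived_ring D \<Theta> \<beta>) T"
  using assms(2)
proof (induction \<alpha> rule: less_induct)
  case (less \<alpha>)
  show ?case
  proof (cases \<alpha> rule: derived_family_cases)
    case zero
    then show ?thesis
      using assms(1) less.prems by (simp add: derived_family_zero)
  next
    case (successor \<gamma>)
    then have "\<gamma> < \<alpha>"
      by (simp add: is_successor_def)
    show ?thesis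
    proof (cases "T \<in> derived_family D \<Theta> \<gamma>")
      case True
      then have "jaffard_overring (derived_ring D \<Theta> \<gamma>) T"
        using less.prems derived_family_successor[OF successor] by (auto simp: jaffard_members_def)
      then show ?thesis
        using True \<open>\<gamma> < \<alpha>\<close> by blast
    next
      case False
      then show ?thesis
        using less.IH[OF \<open>\<gamma> < \<alpha>\<close>] \<open>\<gamma> < \<alpha>\<close> less_trans by blast
    qed
  next
    case limit
    then obtain \<beta> where "\<beta> < \<alpha>" "T \<notin> derived_family D \<Theta> \<beta>"
      using less.prems derived_family_limit[of \<alpha> D \<Theta>] by auto
    then show ?thesis
      using less.IH[of \<beta>] less_trans by blast
  qed
qed

text \<open>For \<open>x\<close> in every member the conductor \<open>(D : x)\<close> blows up
  everywhere by flatness, so completeness puts \<open>1\<close> into it.\<close>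

lemma pre_jaffard_Inter:
  assumes "domain_with_quotient_field D" "pre_jaffard_family D \<Theta>"
  shows "\<Inter>\<Theta> = D"
proof
  note P = pre_jaffardD[OF assms] and D' = dwqfD(1)[OF assms(1)]
  show "D \<subseteq> \<Inter>\<Theta>"
    using P(2) overringsD(2) by blast
  show "\<Inter>\<Theta> \<subseteq> D"
  proof
    fix x assume "x \<in> \<Inter>\<Theta>"
    then have "1 \<in> mult_span (conductor D D x) T" if "T \<in> \<Theta>" for T
      using P(3)[OF that] that by (auto simp: conductor_flat_def)
    moreover have "ideal_on D D"
      using subrngD[OF D'] by (auto simp: ideal_on_def)
    ultimately have "1 \<in> conductor D D x"
      using P(5) ideal_on_conductor[OF D'] by blast
    then show "x \<in> D"
      by (simp add: conductor_def)
  qed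
qed

text \<open>Gives one formula for all stages: stage zero by \<open>pre_jaffard_Inter\<close>, and
  the empty family because \<open>\<Inter>{}\<close> is \<open>UNIV\<close>.\<close>

lemma derived_ring_eq_Inter:
  assumes "domain_with_quotient_field D" "pre_jaffard_family D \<Theta>"
  shows "derived_ring D \<Theta> \<alpha> = \<Inter>(derived_family D \<Theta> \<alpha>)"
  using pre_jaffard_Inter[OF assms]
  by (cases "is_zero \<alpha>") (simp_all add: derived_ring_zero derived_ring_nonzero derived_family_zero)

text \<open>The pre-Jaffard property at stage \<open>\<alpha>\<close> comes from the original
  \<open>D\<close> and \<open>\<Theta>\<close> once compactness is known. The induction supplies it
  at earlier stages, where it separates each lost member from those that remain.\<close>

lemma pre_jaffard_derived:
  fixes \<alpha> :: "'o::wellorder"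
  assumes D: "domain_with_quotient_field D" and \<Theta>: "pre_jaffard_family D \<Theta>"
    and "derived_family D \<Theta> \<alpha> \<noteq> {}"
  shows "finite_covers (derived_family D \<Theta> \<alpha>)"
    and "pre_jaffard_family (derived_ring D \<Theta> \<alpha>) (derived_family D \<Theta> \<alpha>)"
proof -
  note P = pre_jaffardD[OF D \<Theta>]
  have "finite_covers (derived_family D \<Theta> \<alpha>) \<and>
    pre_jaffard_family (derived_ring D \<Theta> \<alpha>) (derived_family D \<Theta> \<alpha>)"
    using assms(3)
  proof (induction \<alpha> rule: less_induct)
    case (less \<alpha>)
    let ?\<Lambda> = "derived_family D \<Theta> \<alpha>"
    have "finite_covers ?\<Lambda>"
      using P(4) derived_family_subset
    proof (rule finite_covers_remainder)
      fix T and F :: "'a set"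
      assume "T \<in> \<Theta> - ?\<Lambda>" and F: "finite F"
      then obtain \<beta> where \<beta>: "\<beta> < \<alpha>" "T \<in> derived_family D \<Theta> \<beta>"
        "jaffard_overring (derived_ring D \<Theta> \<beta>) T" and T: "T \<notin> ?\<Lambda>"
        using leaves_derived_family[of T \<Theta> D \<alpha>] by blast
      let ?\<Phi> = "derived_family D \<Theta> \<beta>" and ?E = "derived_ring D \<Theta> \<beta>"
      \<comment> \<open>The induction hypothesis asks for a nonempty family; \<open>T\<close> is
        still present at stage \<open>\<beta>\<close>.\<close>
      have pre: "pre_jaffard_family ?E ?\<Phi>"
        using less.IH[OF \<beta>(1)] \<beta>(2) by blast
      have "?\<Phi> \<subseteq> overrings D"
        using derived_family_subset P(2) by blast
      then have "?E \<in> overrings D"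
        unfolding derived_ring_eq_Inter[OF D \<Theta>] using overringsD
        by (blast intro!: overringsI subrng_Inter)
      then have "domain_with_quotient_field ?E"
        using D domain_with_quotient_field_overring by blast
      then have "generates_field ?E T (\<Inter>(?\<Phi> - {T}))"
        using pre \<beta>(2,3) by (rule jaffard_overring_generates_field)
      moreover have "?\<Phi> \<subseteq> overrings ?E"
        using pre by (simp add: pre_jaffard_family_def)
      ultimately obtain U where U: "finite U" "U \<subseteq> T" "\<And>A. A \<in> ?\<Phi> - {T} \<Longrightarrow> U \<subseteq> A \<Longrightarrow> F \<subseteq> A"
        using generates_field_neighbourhood F by metis
      have "?\<Lambda> \<subseteq> ?\<Phi> - {T}"
        using derived_family_antimono[OF less_imp_le[OF \<beta>(1)]] T by blast
      then show "\<exists>U. finite U \<and> U \<subseteq> T \<and> (\<forall>A\<in>?\<Lambda>. U \<subseteq> A \<longrightarrow> F \<subseteq> A)"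
        using U by (intro exI[of _ U]) auto
    qed
    then show ?case
      using Inter_compact_subfamily(3)[OF D \<Theta> derived_family_subset less.prems]
      by (simp add: derived_ring_eq_Inter[OF D \<Theta>])
  qed
  then show "finite_covers (derived_family D \<Theta> \<alpha>)"
    "pre_jaffard_family (derived_ring D \<Theta> \<alpha>) (derived_family D \<Theta> \<alpha>)"
    by blast+
qed

section \<open>Families with an intersection or the field adjoined\<close>

lemma generates_field_UNIV:
  assumes "subrng E" "T \<in> overrings E"
  shows "generates_field E T UNIV"
  unfolding generates_field_def
  using subrngD(1)[OF assms(1)] overringsD(1)[OF assms(2)]
  by (auto simp: conductor_def intro: one_in_mult_span_self)

lemma conductor_flat_UNIV:
  assumes "domain_with_quotient_field E"
  shows "conductor_flat E UNIV"
  unfolding conductor_flat_def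
proof
  fix x
  obtain a b where ab: "a \<in> E" "b \<in> E" "b \<noteq> 0" "x = a / b"
    using dwqfD(2)[OF assms, of x] by blast
  then have "b * (1 / b) \<in> mult_span (conductor E E x) UNIV"
    by (intro mult_span_mult) (auto simp: conductor_def)
  then show "1 \<in> mult_span (conductor E E x) UNIV"
    using ab(3) by simp
qed

text \<open>An ideal that blows up in \<open>C\<close> blows up in every ring containing
  \<open>C\<close>, so \<open>C\<close> can stand for all of \<open>\<Lambda>\<close>. The case
  \<open>\<Lambda> = {}\<close> serves to adjoin \<open>K\<close>.\<close>

lemma complete_family_insert:
  assumes E: "subrng E" and J: "J \<union> {C} \<subseteq> overrings E" "\<And>T. T \<in> J \<union> {C} \<Longrightarrow> conductor_flat E T"
    and \<Lambda>: "\<And>T. T \<in> \<Lambda> \<Longrightarrow> C \<subseteq> T"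
    and compl: "\<And>L. ideal_on E L \<Longrightarrow> (\<And>T. T \<in> J \<union> \<Lambda> \<Longrightarrow> 1 \<in> mult_span L T) \<Longrightarrow> 1 \<in> L"
  shows "complete_family E (J \<union> {C})"
proof -
  have "1 \<in> L" if L: "ideal_on E L" "\<forall>T\<in>J \<union> {C}. 1 \<in> mult_span L T" for L
  proof (rule compl[OF L(1)])
    show "1 \<in> mult_span L T" if "T \<in> J \<union> \<Lambda>" for T
      using that L(2) \<Lambda> mult_span_mono[of 1 L C L T] by auto
  qed
  then show ?thesis
    using complete_family_iff[OF E _ J] by simp
qed

lemma independent_family_insert:
  assumes E: "subrng E" and J: "J \<union> {C} \<subseteq> overrings E"
    and "\<And>A B. A \<in> J \<Longrightarrow> B \<in> J \<Longrightarrow> A \<noteq> B \<Longrightarrow> generates_field E A B"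
    and "\<And>A. A \<in> J \<Longrightarrow> A \<noteq> C \<Longrightarrow> generates_field E A C"
  shows "independent_family E (J \<union> {C})"
  unfolding independent_family_def
proof (intro ballI impI)
  fix A B assume "A \<in> J \<union> {C}" "B \<in> J \<union> {C}" "A \<noteq> B"
  \<comment> \<open>Either order suffices, because independence is symmetric although
    \<open>generates_field\<close> is not.\<close>
  then have "generates_field E A B \<or> generates_field E B A" "A \<in> overrings E" "B \<in> overrings E"
    using assms by auto
  then show "contracted_spectrum E A \<inter> contracted_spectrum E B = {{0}}"
    using generates_field_imp_independent[OF E] by blast
qed

lemma weak_jaffard_insert_Inter:
  assumes E: "domain_with_quotient_field E" and \<Theta>: "pre_jaffard_family E \<Theta>"
    and \<Lambda>: "\<Lambda> = \<Theta> - jaffard_members E \<Theta>" "\<Lambda> \<noteq> {}" "finite_covers \<Lambda>"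
  shows "weak_jaffard_family E (jaffard_members E \<Theta> \<union> {\<Inter>\<Lambda>}) (\<Inter>\<Lambda>)"
proof -
  define J where "J = jaffard_members E \<Theta>"
  have J: "J \<subseteq> \<Theta>" "\<And>T. T \<in> J \<Longrightarrow> jaffard_overring E T" "\<Theta> = J \<union> \<Lambda>" "J \<inter> \<Lambda> = {}" "\<Lambda> \<subseteq> \<Theta>"
    using \<Lambda>(1) by (auto simp: J_def jaffard_members_def)
  note E' = dwqfD(1)[OF E] and P = pre_jaffardD[OF E \<Theta>]
    and C = Inter_compact_subfamily[OF E \<Theta> J(5) \<Lambda>(2,3)]
  have over: "J \<union> {\<Inter>\<Lambda>} \<subseteq> overrings E"
    using C(1) P(2) J(1) by blast
  have fl: "conductor_flat E T" if "T \<in> J \<union> {\<Inter>\<Lambda>}" for T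
    using that C(2) P(3) J(1) by blast
  have "complete_family E (J \<union> {\<Inter>\<Lambda>})"
    using P(5) J(3) by (intro complete_family_insert[OF E' over fl, where \<Lambda> = \<Lambda>]) auto
  moreover have "independent_family E (J \<union> {\<Inter>\<Lambda>})"
    using P(6) J C(4) by (intro independent_family_insert[OF E' over]) blast+
  moreover have "UNIV \<notin> J \<union> {\<Inter>\<Lambda>} \<or> J \<union> {\<Inter>\<Lambda>} = {UNIV}"
  proof (cases "UNIV \<in> \<Theta>")
    case True
    then have "\<Theta> = {UNIV}"
      by (rule P(7))
    then have "\<Lambda> = {UNIV}"
      using J(5) \<Lambda>(2) by blast
    moreover have "J = {}"
      using J(1,4) calculation \<open>\<Theta> = {UNIV}\<close> by blast
    ultimately show ?thesis by simp
  next
    case False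
    \<comment> \<open>An intersection equal to \<open>K\<close> forces every member of the nonempty
      family \<open>\<Lambda>\<close> to be \<open>K\<close>.\<close>
    moreover have "UNIV \<in> \<Lambda>" if "\<Inter>\<Lambda> = UNIV"
      using that \<Lambda>(2) by (metis Inter_lower all_not_in_conv top.extremum_unique)
    ultimately show ?thesis
      using J by auto
  qed
  moreover have "flat_overring E (\<Inter>\<Lambda>)"
    using C(1,2) E by (simp add: flat_overring_iff)
  ultimately show ?thesis
    using over J(2) by (auto simp: weak_jaffard_family_def J_def[symmetric])
qed

text \<open>For a stage at which all members of a nonempty family leave, so that the next ring is
  \<open>K\<close>. The clause of \<open>weak_jaffard_family\<close> about \<open>UNIV\<close> then
  fails unless \<open>\<Theta> = {UNIV}\<close>; these clauses still hold.\<close>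

lemma pre_jaffard_insert_UNIV:
  assumes E: "domain_with_quotient_field E" and \<Theta>: "pre_jaffard_family E \<Theta>"
  shows "\<Theta> \<union> {UNIV} \<subseteq> overrings E" "complete_family E (\<Theta> \<union> {UNIV})"
    "independent_family E (\<Theta> \<union> {UNIV})"
proof -
  note E' = dwqfD(1)[OF E] and P = pre_jaffardD[OF E \<Theta>]
  show over: "\<Theta> \<union> {UNIV} \<subseteq> overrings E"
    using P(2) overringsI[OF subrng_UNIV subset_UNIV, of E] by simp
  show "complete_family E (\<Theta> \<union> {UNIV})"
  proof (rule complete_family_insert[OF E' over, where \<Lambda> = "{}"])
    show "conductor_flat E T" if "T \<in> \<Theta> \<union> {UNIV}" for T
      using that P(3) conductor_flat_UNIV[OF E] by auto
    show "1 \<in> L" if "ideal_on E L" "\<And>T. T \<in> \<Theta> \<union> {} \<Longrightarrow> 1 \<in> mult_span L T" for L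
      using P(5) that by simp
  qed simp
  show "independent_family E (\<Theta> \<union> {UNIV})"
  proof (rule independent_family_insert[OF E' over])
    show "generates_field E A B" if "A \<in> \<Theta>" "B \<in> \<Theta>" "A \<noteq> B" for A B
      using P(6) that .
    show "generates_field E A UNIV" if "A \<in> \<Theta>" for A
      using P(2) that by (intro generates_field_UNIV[OF E']) blast
  qed
qed

lemma overrings_UNIV: "overrings (UNIV :: 'k::field set) = {UNIV}"
proof (intro equalityI subsetI)
  fix T :: "'k set"
  show "T \<in> {UNIV}" if "T \<in> overrings UNIV"
    using overringsD(2)[OF that] by auto
  show "T \<in> overrings UNIV" if "T \<in> {UNIV}"
    using that by (auto intro: overringsI subrng_UNIV)
qed

lemma weak_jaffard_family_UNIV: "weak_jaffard_family UNIV {UNIV} (UNIV :: 'k::field set)"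
proof -
  have dom: "domain_with_quotient_field (UNIV :: 'k set)"
    unfolding domain_with_quotient_field_def
  proof (intro conjI allI)
    show "subring (UNIV :: 'k set) (ring_on UNIV)"
      using subrng_UNIV by (simp add: subrng_def)
    show "\<exists>a\<in>UNIV. \<exists>b\<in>UNIV - {0}. x = a / b" for x :: 'k
      by (rule bexI[of _ x], rule bexI[of _ 1]) simp_all
  qed
  have fl: "conductor_flat UNIV (UNIV :: 'k set)"
    using dom by (rule conductor_flat_UNIV)
  have "1 \<in> L" if "ideal_on UNIV L" "1 \<in> mult_span L UNIV" for L :: "'k set"
  proof -
    have "1 * 1 \<in> L"
      using ideal_onD[OF that(1)] by (intro mult_span_absorb[OF that(2)]) auto
    then show ?thesis by simp
  qed
  then have "complete_family UNIV {UNIV :: 'k set}"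
    using fl by (subst complete_family_iff) (auto simp: subrng_UNIV overrings_UNIV)
  then show ?thesis
    using fl dom by (simp add: weak_jaffard_family_def overrings_UNIV independent_family_def
        flat_overring_iff)
qed

text \<open>An empty stage is separated because the empty family is never complete. If the last
  members leave and \<open>T\<^sub>\<gamma>\<close> is not \<open>K\<close>, the point
  \<open>K\<close> cannot belong to a weak Jaffard family with other members, so only the remaining
  clauses are asserted; if \<open>T\<^sub>\<gamma>\<close> is \<open>K\<close>, the weak Jaffard
  family is \<open>{K}\<close>.\<close>

theorem proposition6p1:
  fixes D :: "'k::field set" and \<Theta> :: "'k set set" and \<alpha> :: "'o::wellorder"
  assumes "domain_with_quotient_field D"
    and "pre_jaffard_family D \<Theta>"
  shows "(derived_family D \<Theta> \<alpha> \<noteq> {} \<longrightarrow>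
            pre_jaffard_family (derived_ring D \<Theta> \<alpha>) (derived_family D \<Theta> \<alpha>)) \<and>
         (\<forall>\<gamma>. is_successor \<gamma> \<alpha> \<longrightarrow>
            (let T\<^sub>\<gamma> = derived_ring D \<Theta> \<gamma>;
                 T\<^sub>\<alpha> = derived_ring D \<Theta> \<alpha>;
                 \<Lambda> = jaffard_members T\<^sub>\<gamma> (derived_family D \<Theta> \<gamma>) \<union> {T\<^sub>\<alpha>}
             in (derived_family D \<Theta> \<alpha> \<noteq> {} \<or> T\<^sub>\<gamma> = UNIV \<longrightarrow> weak_jaffard_family T\<^sub>\<gamma> \<Lambda> T\<^sub>\<alpha>) \<and>
                (derived_family D \<Theta> \<alpha> = {} \<longrightarrow>
                   \<Lambda> \<subseteq> overrings T\<^sub>\<gamma> \<and> complete_family T\<^sub>\<gamma> \<Lambda> \<and> independent_family T\<^sub>\<gamma> \<Lambda> \<and>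
                   (\<forall>T \<in> \<Lambda> - {T\<^sub>\<alpha>}. jaffard_overring T\<^sub>\<gamma> T) \<and> flat_overring T\<^sub>\<gamma> T\<^sub>\<alpha>)))"
proof (intro conjI impI allI)
  note P = pre_jaffardD[OF assms]
  show "pre_jaffard_family (derived_ring D \<Theta> \<alpha>) (derived_family D \<Theta> \<alpha>)"
    if "derived_family D \<Theta> \<alpha> \<noteq> {}"
    using pre_jaffard_derived(2)[OF assms that] .
  fix \<gamma> assume \<gamma>: "is_successor \<gamma> \<alpha>"
  define E where "E = derived_ring D \<Theta> \<gamma>"
  define C where "C = derived_ring D \<Theta> \<alpha>"
  define \<Phi> where "\<Phi> = derived_family D \<Theta> \<gamma>"
  define \<Psi> where "\<Psi> = derived_family D \<Theta> \<alpha>"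
  define J where "J = jaffard_members E \<Phi>"
  have C: "C = \<Inter>\<Psi>" and EI: "E = \<Inter>\<Phi>"
    by (simp_all add: C_def \<Psi>_def E_def \<Phi>_def derived_ring_eq_Inter[OF assms])
  have \<Psi>: "\<Psi> = \<Phi> - J"
    by (simp add: \<Psi>_def \<Phi>_def J_def E_def derived_family_successor[OF \<gamma>])
  have JE: "\<forall>T \<in> J \<union> {C} - {C}. jaffard_overring E T"
    by (auto simp: J_def jaffard_members_def)
  have "\<Phi> \<subseteq> overrings D"
    using derived_family_subset P(2) unfolding \<Phi>_def by blast
  then have "E \<in> overrings D"
    unfolding EI using overringsD by (blast intro!: overringsI subrng_Inter)
  then have E: "domain_with_quotient_field E"
    using assms(1) domain_with_quotient_field_overring by blast
  have weak_UNIV: "weak_jaffard_family E (J \<union> {C}) C" if "E = UNIV"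
  proof -
    \<comment> \<open>Every member of \<open>\<Phi>\<close> contains the intersection
      \<open>E = K\<close>; the next ring \<open>C\<close> is then \<open>K\<close> whether or not
      \<open>\<Psi>\<close> is empty.\<close>
    have "\<Phi> \<subseteq> {UNIV}"
      using EI that by auto
    then have "J \<union> {C} = {UNIV}" "C = UNIV"
      using C \<Psi> by (auto simp: J_def jaffard_members_def)
    then show ?thesis
      using weak_jaffard_family_UNIV that by metis
  qed
  have weak: "weak_jaffard_family E (J \<union> {C}) C" if "\<Psi> \<noteq> {} \<or> E = UNIV"
  proof (cases "\<Psi> = {}")
    case True
    then show ?thesis
      using that weak_UNIV by blast
  next
    case False
    then have "\<Phi> \<noteq> {}"
      using \<Psi> by blast
    then have "pre_jaffard_family E \<Phi>"
      using pre_jaffard_derived(2)[OF assms] by (simp add: E_def \<Phi>_def)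
    moreover have "finite_covers \<Psi>"
      using False pre_jaffard_derived(1)[OF assms] by (simp add: \<Psi>_def)
    ultimately show ?thesis
      using weak_jaffard_insert_Inter[OF E, of \<Phi> \<Psi>] False \<Psi> C by (simp add: J_def)
  qed
  have degenerate: "J \<union> {C} \<subseteq> overrings E \<and> complete_family E (J \<union> {C}) \<and>
      independent_family E (J \<union> {C}) \<and> flat_overring E C" if "\<Psi> = {}"
  proof (cases "\<Phi> = {}")
    case True
    then have "E = UNIV"
      using EI by simp
    then show ?thesis
      using weak_UNIV by (simp add: weak_jaffard_family_def)
  next
    case False
    then have pre: "pre_jaffard_family E \<Phi>"
      using pre_jaffard_derived(2)[OF assms] by (simp add: E_def \<Phi>_def)
    have "J = \<Phi>"
      using that \<Psi> by (auto simp: J_def jaffard_members_def)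
    moreover have "C = UNIV"
      using that C by simp
    ultimately show ?thesis
      using pre_jaffard_insert_UNIV[OF E pre] conductor_flat_UNIV[OF E]
      by (simp add: flat_overring_iff[OF E])
  qed
  show "let T\<^sub>\<gamma> = derived_ring D \<Theta> \<gamma>;
                 T\<^sub>\<alpha> = derived_ring D \<Theta> \<alpha>;
                 \<Lambda> = jaffard_members T\<^sub>\<gamma> (derived_family D \<Theta> \<gamma>) \<union> {T\<^sub>\<alpha>}
             in (derived_family D \<Theta> \<alpha> \<noteq> {} \<or> T\<^sub>\<gamma> = UNIV \<longrightarrow> weak_jaffard_family T\<^sub>\<gamma> \<Lambda> T\<^sub>\<alpha>) \<and>
                (derived_family D \<Theta> \<alpha> = {} \<longrightarrow>
                   \<Lambda> \<subseteq> overrings T\<^sub>\<gamma> \<and> complete_family T\<^sub>\<gamma> \<Lambda> \<and> independent_family T\<^sub>\<gamma> \<Lambda> \<and>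
                   (\<forall>T \<in> \<Lambda> - {T\<^sub>\<alpha>}. jaffard_overring T\<^sub>\<gamma> T) \<and> flat_overring T\<^sub>\<gamma> T\<^sub>\<alpha>)"
    using weak degenerate JE
    unfolding Let_def E_def[symmetric] C_def[symmetric] \<Phi>_def[symmetric] \<Psi>_def[symmetric]
      J_def[symmetric] by blast
qed

end
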